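(* Fix $n\in\mathbb{N}$ and let $\{a_i\}_{i=1}^\infty$ be a sequence of real numbers with $a_i\ge 0$ and $\sum_{i=1}^\infty a_i<\infty$. Let $$\mathcal{F}=\{p=\{p_i\}_{i=1}^\infty\in\Delta\cap X \mid 0\le p_i\le a_i \text{ for all } i\in\mathbb{N}\},$$ and assume that $\mathcal{F}\neq\emptyset$. Then each of the two minimization problems $$\text{minimize } f(p)=-\log\prod_{k=1}^n\mu_k(W(p)) \quad\text{subject to } p\in\mathcal{F},$$ $$\text{minimize } g(p)=\sum_{k=1}^n\frac{1}{\mu_k(W(p))} \quad\text{subject to } p\in\mathcal{F},$$ has an optimal solution.
   Context: $\mathcal{H}$ is an infinite-dimensional separable real Hilbert space with a fixed complete orthonormal system $\{e_i\}_{i=1}^\infty$. $A$ is the infinitesimal generator of a strongly continuous semigroup $\exp(tA)$ on $\mathcal{H}$ that is exponentially stable: there are constants $M,\omega>0$ with $\|\exp(tA)\|\le M e^{-\omega t}$ for all $t\ge 0$. $\Delta=\{\{p_i\}_{i=1}^\infty \mid p_i\ge 0,\ \sum_{i=1}^\infty p_i=1\}$. For $p\in\Delta$, $B=B(p)$ is the bounded linear operator on $\mathcal{H}$ with $Be_i=\sqrt{p_i}\,e_i$ for all $i\in\mathbb{N}$, and the controllability Gramian is $$W(p)=\int_0^\infty \exp(tA)BB^*\exp(tA)^*\,\mathrm{d}t .$$ $W(p)$ is a compact, self-adjoint, positive semidefinite operator; $\mu_k(W(p))$ denotes its $k$-th eigenvalue when the eigenvalues are listed in descending order, counted with multiplicity.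 For the fixed $n$, $X=\{\{p_i\}_{i=1}^\infty\mid \mu_n(W(p))>0\}$. *)

theory Defs
  imports "HOL-Analysis.Analysis"
begin

text \<open>
  The Hilbert space is a type of sort \<open>{real_inner, banach, second_countable_topology}\<close>: a complete
  real inner product space that is separable. Infinite-dimensionality is carried by the orthonormal
  system \<open>e\<close>, which is indexed by all of \<open>nat\<close>. Sequences indexed by \<open>1, 2, \<dots>\<close> on paper
  (\<open>e\<close>, \<open>p\<close>, \<open>a\<close>) are indexed by \<open>0, 1, \<dots>\<close> here; the eigenvalues \<open>\<mu>\<close> keep their
  numbering from \<open>1\<close>.
\<close>

definition complete_orthonormal_system :: "(nat \<Rightarrow> 'a::real_inner) \<Rightarrow> bool" where
  "complete_orthonormal_system e \<longleftrightarrow>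
     (\<forall>i j. e i \<bullet> e j = (if i = j then 1 else 0)) \<and> closure (span (range e)) = UNIV"

text \<open>Only the values \<open>T t\<close> with \<open>t \<ge> 0\<close> are constrained or used.\<close>

definition C0_semigroup :: "(real \<Rightarrow> 'a::real_normed_vector \<Rightarrow>\<^sub>L 'a) \<Rightarrow> bool" where
  "C0_semigroup T \<longleftrightarrow>
     T 0 = id_blinfun \<and>
     (\<forall>s\<ge>0. \<forall>t\<ge>0. T (s + t) = T s o\<^sub>L T t) \<and>
     (\<forall>x. ((\<lambda>t. T t x) \<longlongrightarrow> x) (at_right 0))"

text \<open>
  The (in general unbounded) generator is given by its domain \<open>D\<close> and a function \<open>A\<close> whose values
  matter on \<open>D\<close> only.
\<close>

definition infinitesimal_generator ::
    "'a set \<Rightarrow> ('a \<Rightarrow> 'a) \<Rightarrow> (real \<Rightarrow> 'a::real_normed_vector \<Rightarrow>\<^sub>L 'a) \<Rightarrow> bool" where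
  "infinitesimal_generator D A T \<longleftrightarrow>
     D = {x. \<exists>y. ((\<lambda>h. (T h x - x) /\<^sub>R h) \<longlongrightarrow> y) (at_right 0)} \<and>
     (\<forall>x\<in>D. ((\<lambda>h. (T h x - x) /\<^sub>R h) \<longlongrightarrow> A x) (at_right 0))"

definition exponentially_stable :: "(real \<Rightarrow> 'a::real_normed_vector \<Rightarrow>\<^sub>L 'a) \<Rightarrow> bool" where
  "exponentially_stable T \<longleftrightarrow>
     (\<exists>M>0. \<exists>\<omega>>0. \<forall>t\<ge>0. norm (T t) \<le> M * exp (- \<omega> * t))"

definition Simplex :: "(nat \<Rightarrow> real) set" where
  "Simplex = {p. (\<forall>i. 0 \<le> p i) \<and> p sums 1}"

text \<open>
  For bounded nonnegative \<open>p\<close>, in particular on the simplex, this operator exists and is unique when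
  \<open>e\<close> is a complete orthonormal system.
\<close>

definition input_op :: "(nat \<Rightarrow> 'a::real_inner) \<Rightarrow> (nat \<Rightarrow> real) \<Rightarrow> 'a \<Rightarrow>\<^sub>L 'a" where
  "input_op e p = (THE B :: 'a \<Rightarrow>\<^sub>L 'a. \<forall>i. B (e i) = sqrt (p i) *\<^sub>R e i)"

text \<open>
  The operator integral is taken in the strong sense: \<open>W(p) x\<close> is the Bochner integral of
  \<open>t \<mapsto> exp(tA) B B* exp(tA)* x\<close>, with \<open>T t\<close> standing for \<open>exp(tA)\<close>.
\<close>

definition gramian ::
    "(real \<Rightarrow> 'a \<Rightarrow>\<^sub>L 'a) \<Rightarrow> (nat \<Rightarrow> 'a) \<Rightarrow> (nat \<Rightarrow> real) \<Rightarrow>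
     'a::{real_inner, banach, second_countable_topology} \<Rightarrow> 'a" where
  "gramian T e p x =
     (let B = input_op e p
      in LBINT t:{0..}. T t (B (adjoint (blinfun_apply B) (adjoint (blinfun_apply (T t)) x))))"

definition eigenvalue :: "('a::real_vector \<Rightarrow> 'a) \<Rightarrow> real \<Rightarrow> bool" where
  "eigenvalue W l \<longleftrightarrow> (\<exists>x. x \<noteq> 0 \<and> W x = l *\<^sub>R x)"

text \<open>
  \<open>m 0 \<ge> m 1 \<ge> \<dots>\<close> lists the eigenvalues of a compact, self-adjoint, positive semidefinite operator
  on an infinite-dimensional space with multiplicity. The nonzero eigenvalues have finite
  multiplicity. No count is prescribed for \<open>0\<close>: it fills up the list if there are only
  finitely many positive eigenvalues (its eigenspace is then infinite-dimensional), and it is never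
  reached otherwise.
\<close>

definition eigenvalue_listing :: "('a::real_vector \<Rightarrow> 'a) \<Rightarrow> (nat \<Rightarrow> real) \<Rightarrow> bool" where
  "eigenvalue_listing W m \<longleftrightarrow>
     antimono m \<and> (\<forall>k. eigenvalue W (m k)) \<and>
     (\<forall>l. l \<noteq> 0 \<longrightarrow> finite {k. m k = l} \<and> card {k. m k = l} = dim {x. W x = l *\<^sub>R x})"

text \<open>The \<open>k\<close>-th eigenvalue in descending order, for \<open>k \<ge> 1\<close>.\<close>

definition mu :: "('a::real_vector \<Rightarrow> 'a) \<Rightarrow> nat \<Rightarrow> real" where
  "mu W k = (THE m. eigenvalue_listing W m) (k - 1)"

definition X_set ::
    "(real \<Rightarrow> 'a \<Rightarrow>\<^sub>L 'a) \<Rightarrow> (nat \<Rightarrow> 'a::{real_inner, banach, second_countable_topology}) \<Rightarrow>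
     nat \<Rightarrow> (nat \<Rightarrow> real) set" where
  "X_set T e n = {p. mu (gramian T e p) n > 0}"

definition feasible ::
    "(real \<Rightarrow> 'a \<Rightarrow>\<^sub>L 'a) \<Rightarrow> (nat \<Rightarrow> 'a::{real_inner, banach, second_countable_topology}) \<Rightarrow>
     nat \<Rightarrow> (nat \<Rightarrow> real) \<Rightarrow> (nat \<Rightarrow> real) set" where
  "feasible T e n a = {p \<in> Simplex \<inter> X_set T e n. \<forall>i. 0 \<le> p i \<and> p i \<le> a i}"

definition f_obj ::
    "(real \<Rightarrow> 'a \<Rightarrow>\<^sub>L 'a) \<Rightarrow> (nat \<Rightarrow> 'a::{real_inner, banach, second_countable_topology}) \<Rightarrow>
     nat \<Rightarrow> (nat \<Rightarrow> real) \<Rightarrow> real" where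
  "f_obj T e n p = - ln (\<Prod>k=1..n. mu (gramian T e p) k)"

definition g_obj ::
    "(real \<Rightarrow> 'a \<Rightarrow>\<^sub>L 'a) \<Rightarrow> (nat \<Rightarrow> 'a::{real_inner, banach, second_countable_topology}) \<Rightarrow>
     nat \<Rightarrow> (nat \<Rightarrow> real) \<Rightarrow> real" where
  "g_obj T e n p = (\<Sum>k=1..n. 1 / mu (gramian T e p) k)"

definition optimal_solution :: "('b \<Rightarrow> real) \<Rightarrow> 'b set \<Rightarrow> 'b \<Rightarrow> bool" where
  "optimal_solution h S p \<longleftrightarrow> p \<in> S \<and> (\<forall>q\<in>S. h p \<le> h q)"

end

theory Submission
  imports Defs
begin

text \<open>
  Since \<open>B B\<^sup>* x = \<Sum> p\<^sub>i \<langle>x, e\<^sub>i\<rangle> e\<^sub>i\<close>, the Gramian is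
  \<open>W(p) x = \<integral> \<Sum> p\<^sub>i \<langle>x, exp(tA) e\<^sub>i\<rangle> exp(tA) e\<^sub>i dt\<close>, which is linear in \<open>p\<close> and bounded in operator norm
  by \<open>C \<Sum> \<bar>p\<^sub>i\<bar>\<close>. It has finite trace, so it is Hilbert-Schmidt and hence compact. By the Courant-Fischer
  principle its eigenvalues satisfy Weyl's inequality \<open>\<bar>\<mu>\<^sub>k(W(p)) - \<mu>\<^sub>k(W(q))\<bar> \<le> C \<Sum> \<bar>p\<^sub>i - q\<^sub>i\<bar>\<close>. The
  points of the simplex dominated by \<open>a\<close> form a compact set in the product topology, on which the right-hand side
  is continuous by dominated convergence; so every \<open>\<mu>\<^sub>k(W(p))\<close> is continuous there. A maximiser of
  \<open>\<Prod> \<mu>\<^sub>k(W(p))\<close> over this compact set has \<open>\<mu>\<^sub>n > 0\<close> because some feasible point does, and it solves the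
  first problem; the second reduces to a compact set \<open>{\<mu>\<^sub>n \<ge> \<delta>}\<close>.
\<close>

section \<open>Eigenvalues of compact positive semidefinite operators\<close>

text \<open>A dimension count: \<open>P\<close> maps the span of \<open>B\<close> into the span of
  \<open>k\<close> vectors, so it has a nonzero kernel vector \<open>x\<close> there. Since
  \<open>x \<bullet> P x\<close> is the sum of the squares \<open>(x \<bullet> u i)\<^sup>2\<close>,
  \<open>P x = 0\<close> forces each of them to vanish.\<close>

lemma span_orthogonal_to_fewer_vectors:
  fixes B :: "'a::real_inner set" and u :: "nat \<Rightarrow> 'a"
  assumes "finite B" "independent B" "k < card B"
  obtains x where "x \<in> span B" "norm x = 1" "\<And>i. i < k \<Longrightarrow> x \<bullet> u i = 0"
proof -
  define P where "P x = (\<Sum>i<k. (x \<bullet> u i) *\<^sub>R u i)" for x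
  have lin: "linear P"
    unfolding P_def by (intro linearI) (simp_all add: inner_add_left scaleR_add_left sum.distrib scaleR_sum_right)
  have "\<not> inj_on P (span B)"
  proof
    assume inj: "inj_on P (span B)"
    then have ind: "independent (P ` B)"
      using linear_independent_injective_image[OF lin assms(2)] by simp
    have "P ` B \<subseteq> span (u ` {..<k})"
      unfolding P_def by (blast intro: span_sum span_scale span_base imageI)
    then have "card (P ` B) \<le> card (u ` {..<k})"
      using independent_span_bound[OF _ ind] by simp
    also have "\<dots> \<le> k" using card_image_le[of "{..<k}" u] by simp
    also have "\<dots> < card (P ` B)"
      using assms(3) card_image inj inj_on_subset[OF inj span_superset] by metis
    finally show False by simp
  qed
  then obtain x where x: "x \<in> span B" "x \<noteq> 0" "P x = 0"
    using linear_injective_on_subspace_0[OF lin subspace_span] by blast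
  have "(\<Sum>i<k. (x \<bullet> u i)\<^sup>2) = x \<bullet> P x"
    by (simp add: P_def inner_sum_right power2_eq_square)
  then have "\<forall>i<k. x \<bullet> u i = 0"
    using x(3) by (simp add: sum_nonneg_eq_0_iff)
  then show thesis
    using x by (intro that[of "x /\<^sub>R norm x"]) (auto intro: span_scale)
qed

section \<open>Orthonormal sequences and expansions in finite spans\<close>

definition orthonormal_seq :: "(nat \<Rightarrow> 'a::real_inner) \<Rightarrow> bool" where
  "orthonormal_seq v \<longleftrightarrow> (\<forall>i j. v i \<bullet> v j = (if i = j then 1 else 0))"

lemma orthonormal_seq_norm: "orthonormal_seq v \<Longrightarrow> norm (v i) = 1"
  by (simp add: orthonormal_seq_def norm_eq_1)

lemma orthonormal_seq_inj: "orthonormal_seq v \<Longrightarrow> inj_on v S"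
  unfolding orthonormal_seq_def inj_on_def by (metis zero_neq_one)

lemma orthonormal_seq_independent:
  assumes "orthonormal_seq v"
  shows "independent (v ` S)"
proof (rule pairwise_orthogonal_independent)
  show "pairwise orthogonal (v ` S)"
    using assms by (auto simp: pairwise_def orthogonal_def orthonormal_seq_def)
  show "0 \<notin> v ` S"
    using orthonormal_seq_norm[OF assms] by (metis imageE norm_zero zero_neq_one)
qed

lemma orthonormal_seq_card: "orthonormal_seq v \<Longrightarrow> card (v ` S) = card S"
  by (simp add: card_image orthonormal_seq_inj)

lemma orthonormal_seq_inner: "orthonormal_seq v \<Longrightarrow> v i \<bullet> v j = (if i = j then 1 else 0)"
  by (simp add: orthonormal_seq_def)

lemma orthonormal_seq_sum_inner:
  assumes "orthonormal_seq v" "finite S"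
  shows "(\<Sum>i\<in>S. c i *\<^sub>R v i) \<bullet> v j = (if j \<in> S then c j else 0)"
  using assms(2) by (simp add: inner_sum_left orthonormal_seq_inner[OF assms(1)] if_distrib sum.delta cong: if_cong)

lemma orthonormal_seq_expand_span:
  assumes "orthonormal_seq v" "finite S" "x \<in> span (v ` S)"
  shows "x = (\<Sum>j\<in>S. (x \<bullet> v j) *\<^sub>R v j)"
  using assms(3)
proof (induction rule: span_induct)
  case base
  show ?case
    by (simp add: subspace_def inner_add_left scaleR_add_left sum.distrib)
       (metis (no_types, lifting) scaleR_scaleR scaleR_sum_right sum.cong)
next
  case (step x)
  then obtain i where i: "i \<in> S" "x = v i" by auto
  have "(\<Sum>j\<in>S. (x \<bullet> v j) *\<^sub>R v j) = (\<Sum>j\<in>S. if j = i then v j else 0)"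
    unfolding i(2) by (intro sum.cong) (auto simp: orthonormal_seq_inner[OF assms(1)])
  then show ?case using i assms(2) by (simp add: sum.delta)
qed

section \<open>Positive semidefinite operators and their forms\<close>

locale psd_operator =
  fixes W :: "'a::real_inner \<Rightarrow> 'a"
  assumes bounded_linear: "bounded_linear W"
    and symmetric: "W x \<bullet> y = x \<bullet> W y"
    and psd: "0 \<le> W x \<bullet> x"
begin

sublocale bounded_linear W by (rule bounded_linear)

text \<open>The form is nonnegative at \<open>x + t *\<^sub>R y\<close> for every real
  \<open>t\<close>, so this quadratic polynomial in \<open>t\<close> has nonpositive discriminant.
  It degenerates to a linear one when \<open>W y \<bullet> y = 0\<close>.\<close>

lemma Cauchy_Schwarz_form: "(W x \<bullet> y)\<^sup>2 \<le> (W x \<bullet> x) * (W y \<bullet> y)"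
proof -
  have *: "0 \<le> (W x \<bullet> x) + 2 * t * (W x \<bullet> y) + t\<^sup>2 * (W y \<bullet> y)" for t
    using psd[of "x + t *\<^sub>R y"] symmetric[of x y]
    by (simp add: add scale inner_add_left inner_add_right inner_commute algebra_simps power2_eq_square)
  show ?thesis
  proof (cases "W y \<bullet> y = 0")
    case True
    have "W x \<bullet> y = 0"
    proof (rule ccontr)
      assume "W x \<bullet> y \<noteq> 0"
      \<comment> \<open>This \<open>t\<close> gives the expression, now linear in \<open>t\<close>,
        the value -1.\<close>
      then show False
        using *[of "- (W x \<bullet> x + 1) / (2 * (W x \<bullet> y))"] True psd[of x] by (simp add: field_simps)
    qed
    then show ?thesis using True by simp
  next
    case False
    then have pos: "W y \<bullet> y > 0" using psd[of y] by simp
    have "0 \<le> (W x \<bullet> x) - (W x \<bullet> y)\<^sup>2 / (W y \<bullet> y)"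
      using *[of "- (W x \<bullet> y) / (W y \<bullet> y)"] pos by (simp add: power2_eq_square field_simps)
    then show ?thesis using pos by (simp add: field_simps)
  qed
qed

lemma zero_if_form_zero:
  assumes "W x \<bullet> x = 0"
  shows "W x = 0"
  using Cauchy_Schwarz_form[of x "W x"] assms by simp

text \<open>Cauchy-Schwarz for the form at \<open>x\<close> and \<open>W x\<close>. It turns a bound
  on the form into a bound on the norm. The bound is asked for at \<open>W x\<close> alone, so that
  it can be applied on an invariant subspace.\<close>

lemma norm_power2_le:
  assumes C: "W (W x) \<bullet> W x \<le> C * (norm (W x))\<^sup>2"
  shows "(norm (W x))\<^sup>2 \<le> C * (W x \<bullet> x)"
proof (cases "W x = 0")
  case False
  have "((norm (W x))\<^sup>2)\<^sup>2 \<le> (W x \<bullet> x) * (W (W x) \<bullet> W x)"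
    using Cauchy_Schwarz_form[of x "W x"] by (simp add: dot_square_norm)
  also have "\<dots> \<le> (W x \<bullet> x) * (C * (norm (W x))\<^sup>2)"
    by (intro mult_left_mono C psd)
  finally have "(norm (W x))\<^sup>2 * (norm (W x))\<^sup>2 \<le> (C * (W x \<bullet> x)) * (norm (W x))\<^sup>2"
    by (simp add: power2_eq_square algebra_simps)
  then show ?thesis using False by (meson mult_right_le_imp_le zero_less_norm_iff zero_less_power)
qed (simp add: inner_commute)

end

section \<open>Eigenvectors of compact positive semidefinite operators\<close>

locale compact_psd_operator = psd_operator W
  for W :: "'a::real_inner \<Rightarrow> 'a" +
  assumes compact: "bounded (range (X :: nat \<Rightarrow> 'a)) \<Longrightarrow> \<exists>r. strict_mono r \<and> convergent (W \<circ> X \<circ> r)"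
begin

text \<open>
  With \<open>\<sigma>\<close> the supremum of the form on the unit sphere of \<open>M\<close>, the operator \<open>\<sigma> - W\<close> is positive
  semidefinite on \<open>M\<close>, so a maximising sequence \<open>x\<close> satisfies \<open>\<sigma> x - W x \<rightarrow> 0\<close>; compactness makes
  \<open>W x\<close>, and hence \<open>x\<close> itself, converge along a subsequence.
\<close>

lemma maximal_eigenvector:
  assumes M: "subspace M" "closed M" "W ` M \<subseteq> M" and u: "u \<in> M" "norm u = 1"
  obtains x where "x \<in> M" "norm x = 1" "W x = (W x \<bullet> x) *\<^sub>R x"
    "\<And>y. y \<in> M \<Longrightarrow> W y \<bullet> y \<le> (W x \<bullet> x) * (norm y)\<^sup>2"
proof -
  define S where "S = (\<lambda>x. W x \<bullet> x) ` {x \<in> M. norm x = 1}"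
  define \<sigma> where "\<sigma> = Sup S"
  obtain K where K: "\<And>x. norm (W x) \<le> norm x * K" using bounded by blast
  have bdd: "bdd_above S"
  proof (rule bdd_aboveI)
    fix s assume "s \<in> S"
    then obtain x where "norm x = 1" "s = W x \<bullet> x" by (auto simp: S_def)
    then show "s \<le> K" using norm_cauchy_schwarz[of "W x" x] K[of x] by simp
  qed
  have S: "S \<noteq> {}" using u by (auto simp: S_def)
  have le: "W y \<bullet> y \<le> \<sigma> * (norm y)\<^sup>2" if "y \<in> M" for y
  proof (cases "y = 0")
    case False
    have "W (y /\<^sub>R norm y) \<bullet> (y /\<^sub>R norm y) \<le> \<sigma>"
      unfolding \<sigma>_def S_def using False that M(1)
      by (intro cSup_upper bdd[unfolded S_def] imageI) (auto simp: subspace_scale)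
    then show ?thesis using False by (simp add: scale field_simps power2_eq_square)
  qed (simp add: zero)
  have "0 \<le> \<sigma>" using le[OF u(1)] psd[of u] u(2) by simp
  show thesis
  proof (cases "\<sigma> = 0")
    \<comment> \<open>Here the form vanishes at \<open>u\<close>, so \<open>u\<close> itself is an
      eigenvector for 0. The other case divides by \<open>\<sigma>\<close>.\<close>
    case True
    then have "W u \<bullet> u = 0" using le[OF u(1)] psd[of u] by simp
    then show thesis using True u le zero_if_form_zero[of u] by (intro that[of u]) auto
  next
    case False
    with \<open>0 \<le> \<sigma>\<close> have pos: "\<sigma> > 0" by simp
    have "\<exists>x. x \<in> M \<and> norm x = 1 \<and> \<sigma> - inverse (real (Suc i)) < W x \<bullet> x" for i
      using less_cSupD[OF S, of "\<sigma> - inverse (real (Suc i))"] unfolding \<sigma>_def[symmetric]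
      by (auto simp: S_def)
    then obtain x where x: "\<And>i. x i \<in> M" "\<And>i. norm (x i) = 1"
        "\<And>i. \<sigma> - inverse (real (Suc i)) < W (x i) \<bullet> x i"
      by metis
    have "bounded (range x)" using x(2) by (auto simp: bounded_iff intro!: exI[of _ 1])
    then obtain r y where r: "strict_mono r" and y: "(W \<circ> x \<circ> r) \<longlonglongrightarrow> y"
      using compact unfolding convergent_def by metis
    \<comment> \<open>Expanding the square and bounding \<open>(norm (W (x i)))\<^sup>2\<close> by
      \<open>\<sigma> * (W (x i) \<bullet> x i)\<close> leaves
      \<open>\<sigma> * (\<sigma> - W (x i) \<bullet> x i)\<close>, which the maximising choice of
      \<open>x i\<close> makes small.\<close>
    have defect: "(norm (\<sigma> *\<^sub>R x i - W (x i)))\<^sup>2 \<le> 2 * \<sigma> * inverse (real (Suc i))" for i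
    proof -
      have ii: "x i \<bullet> x i = 1" using x(2)[of i] by (simp add: norm_eq_1)
      have "(norm (W (x i)))\<^sup>2 \<le> \<sigma> * (W (x i) \<bullet> x i)"
        using M(3) x(1) by (intro norm_power2_le le) auto
      moreover have "(norm (\<sigma> *\<^sub>R x i - W (x i)))\<^sup>2 = \<sigma>\<^sup>2 - 2 * \<sigma> * (W (x i) \<bullet> x i) + (norm (W (x i)))\<^sup>2"
        using ii unfolding power2_norm_eq_inner
        by (simp add: inner_diff_left inner_diff_right inner_commute power2_eq_square algebra_simps)
      ultimately have "(norm (\<sigma> *\<^sub>R x i - W (x i)))\<^sup>2 \<le> \<sigma> * (\<sigma> - W (x i) \<bullet> x i)"
        by (simp add: power2_eq_square algebra_simps)
      also have "\<dots> \<le> \<sigma> * inverse (real (Suc i))"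
        using x(3)[of i] pos by (intro mult_left_mono) auto
      also have "\<dots> \<le> 2 * \<sigma> * inverse (real (Suc i))" using pos by simp
      finally show ?thesis .
    qed
    have "(\<lambda>i. (norm (\<sigma> *\<^sub>R x i - W (x i)))\<^sup>2) \<longlonglongrightarrow> 0"
    proof (rule tendsto_sandwich[OF _ _ tendsto_const])
      show "(\<lambda>i. 2 * \<sigma> * inverse (real (Suc i))) \<longlonglongrightarrow> 0"
        using tendsto_mult_right_zero[OF LIMSEQ_inverse_real_of_nat] .
    qed (use defect in auto)
    then have "(\<lambda>i. norm (\<sigma> *\<^sub>R x i - W (x i))) \<longlonglongrightarrow> 0"
      using tendsto_real_sqrt[of _ 0] by fastforce
    then have "(\<lambda>i. \<sigma> *\<^sub>R x i - W (x i)) \<longlonglongrightarrow> 0" by (rule tendsto_norm_zero_cancel)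
    then have "(\<lambda>i. \<sigma> *\<^sub>R x (r i) - W (x (r i))) \<longlonglongrightarrow> 0"
      using LIMSEQ_subseq_LIMSEQ[OF _ r] by (fastforce simp: o_def)
    then have "(\<lambda>i. (\<sigma> *\<^sub>R x (r i) - W (x (r i)) + W (x (r i))) /\<^sub>R \<sigma>) \<longlonglongrightarrow> (0 + y) /\<^sub>R \<sigma>"
      using y by (intro tendsto_intros) (auto simp: o_def)
    then have lim: "(\<lambda>i. x (r i)) \<longlonglongrightarrow> y /\<^sub>R \<sigma>" using pos by simp
    define z where "z = y /\<^sub>R \<sigma>"
    have "z \<in> M"
      unfolding z_def by (rule closed_sequentially[OF M(2) _ lim]) (use x in auto)
    have "norm z = 1"
      using LIMSEQ_unique[OF tendsto_norm[OF lim]] x(2) by (simp add: z_def)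
    have "(\<lambda>i. W (x (r i))) \<longlonglongrightarrow> W z"
      unfolding z_def by (rule tendsto[OF lim])
    then have "W z = y" using y LIMSEQ_unique by (auto simp: o_def)
    then have Wz: "W z = \<sigma> *\<^sub>R z" using pos by (simp add: z_def)
    have "W z \<bullet> z = \<sigma>" unfolding Wz using \<open>norm z = 1\<close> by (simp add: norm_eq_1)
    show thesis by (rule that[of z]) (use \<open>z \<in> M\<close> \<open>norm z = 1\<close> Wz le in \<open>simp_all add: norm_eq_1\<close>)
  qed
qed

text \<open>Each \<open>v k\<close> maximises the form among unit vectors orthogonal to its
  predecessors; the last clause is the upper half of the Courant-Fischer principle. The sequence may
  fail to be complete, since it can miss part of the kernel of \<open>W\<close>.\<close>

definition eigensystem :: "(nat \<Rightarrow> 'a) \<Rightarrow> bool" where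
  "eigensystem v \<longleftrightarrow> orthonormal_seq v \<and> (\<forall>k. W (v k) = (W (v k) \<bullet> v k) *\<^sub>R v k) \<and>
     (\<forall>k y. (\<forall>i<k. y \<bullet> v i = 0) \<longrightarrow> W y \<bullet> y \<le> (W (v k) \<bullet> v k) * (norm y)\<^sup>2)"

text \<open>Greedy recursion: \<open>v k\<close> is a maximal eigenvector on the orthogonal
  complement of the earlier ones. That complement is closed, and invariant because \<open>W\<close>
  is symmetric and the earlier vectors are eigenvectors.\<close>

lemma eigensystem_exists:
  assumes e: "orthonormal_seq (e :: nat \<Rightarrow> 'a)"
  obtains v where "eigensystem v"
proof -
  define P where "P f k r \<longleftrightarrow> norm r = 1 \<and> (\<forall>i<k. r \<bullet> f i = 0) \<and> W r = (W r \<bullet> r) *\<^sub>R r \<and>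
     (\<forall>y. (\<forall>i<k. y \<bullet> f i = 0) \<longrightarrow> W y \<bullet> y \<le> (W r \<bullet> r) * (norm y)\<^sup>2)"
    for f :: "nat \<Rightarrow> 'a" and k :: nat and r :: 'a
  have "\<exists>v. \<forall>k. P v k (v k)"
  proof (rule dependent_wf_choice[OF wf_less])
    fix f g :: "nat \<Rightarrow> 'a" and k r assume "\<And>z. (z, k) \<in> {(x, y). x < y} \<Longrightarrow> f z = g z"
    then show "P f k r = P g k r" by (simp add: P_def)
  next
    fix k and f :: "nat \<Rightarrow> 'a"
    assume prev: "\<And>y. (y, k) \<in> {(x, y). x < y} \<Longrightarrow> P f y (f y)"
    define M where "M = {x. \<forall>i<k. x \<bullet> f i = 0}"
    have M: "subspace M" by (auto simp: M_def subspace_def inner_add_left)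
    have "M = (\<Inter>i\<in>{..<k}. {x. x \<bullet> f i = 0})" by (auto simp: M_def)
    then have cl: "closed M" by (auto intro!: closed_INT closed_Collect_eq continuous_intros)
    have inv: "W ` M \<subseteq> M"
    proof
      fix y assume "y \<in> W ` M"
      then obtain x where x: "x \<in> M" "y = W x" by auto
      show "y \<in> M" unfolding M_def
      proof (intro CollectI allI impI)
        fix i assume i: "i < k"
        then have "W (f i) = (W (f i) \<bullet> f i) *\<^sub>R f i" using prev[of i] by (simp add: P_def)
        then obtain l where l: "W (f i) = l *\<^sub>R f i" ..
        have "y \<bullet> f i = x \<bullet> W (f i)" using x symmetric by simp
        also have "\<dots> = 0" using x i unfolding l by (simp add: M_def)
        finally show "y \<bullet> f i = 0" .
      qed
    qed
    \<comment> \<open>Infinite dimension enters here: among the combinations of \<open>k + 1\<close>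
      vectors of \<open>e\<close> there is a unit vector orthogonal to the \<open>k\<close> vectors
      already chosen.\<close>
    obtain u where "u \<in> span (e ` {..k})" "norm u = 1" "\<And>i. i < k \<Longrightarrow> u \<bullet> f i = 0"
      using span_orthogonal_to_fewer_vectors[of "e ` {..k}" k f]
        orthonormal_seq_independent[OF e] orthonormal_seq_card[OF e] by auto
    then have u: "u \<in> M" "norm u = 1" by (auto simp: M_def)
    obtain x where "x \<in> M" "norm x = 1" "W x = (W x \<bullet> x) *\<^sub>R x"
        "\<And>y. y \<in> M \<Longrightarrow> W y \<bullet> y \<le> (W x \<bullet> x) * (norm y)\<^sup>2"
      using maximal_eigenvector[OF M cl inv u] by blast
    then show "\<exists>r. P f k r" by (auto simp: P_def M_def)
  qed
  then obtain v where v: "\<And>k. P v k (v k)" by blast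
  have "v i \<bullet> v j = 0" if "i \<noteq> j" for i j
    using v[of i] v[of j] that by (cases i j rule: linorder_cases) (auto simp: P_def inner_commute)
  moreover have "v i \<bullet> v i = 1" for i using v[of i] by (simp add: P_def norm_eq_1)
  ultimately have "orthonormal_seq v" by (simp add: orthonormal_seq_def)
  then have "eigensystem v" using v by (simp add: eigensystem_def P_def)
  then show thesis by (rule that)
qed

definition ev :: "(nat \<Rightarrow> 'a) \<Rightarrow> nat \<Rightarrow> real" where
  "ev v k = W (v k) \<bullet> v k"

context
  fixes v assumes v: "eigensystem v"
begin

lemma eigensystem_orthonormal: "orthonormal_seq v"
  using v by (simp add: eigensystem_def)

lemma eigensystem_eq: "W (v k) = ev v k *\<^sub>R v k"
  unfolding ev_def by (metis eigensystem_def v)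

lemma eigensystem_le: "(\<And>i. i < k \<Longrightarrow> y \<bullet> v i = 0) \<Longrightarrow> W y \<bullet> y \<le> ev v k * (norm y)\<^sup>2"
  using v by (auto simp: eigensystem_def ev_def)

lemma ev_nonneg: "0 \<le> ev v k"
  by (simp add: ev_def psd)

lemma ev_antimono: "antimono (ev v)"
proof (rule decseq_SucI)
  fix k
  have "v (Suc k) \<bullet> v i = 0" if "i < k" for i
    using eigensystem_orthonormal that by (simp add: orthonormal_seq_def)
  then have "W (v (Suc k)) \<bullet> v (Suc k) \<le> ev v k * (norm (v (Suc k)))\<^sup>2" by (rule eigensystem_le)
  then show "ev v (Suc k) \<le> ev v k"
    by (simp add: ev_def[of v "Suc k"] orthonormal_seq_norm[OF eigensystem_orthonormal])
qed

text \<open>The lower half of the Courant-Fischer principle: on this span \<open>W\<close> is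
  diagonal, so the form is a weighted sum of squared coordinates whose smallest weight is
  \<open>ev v k\<close>.\<close>

lemma form_span_ge:
  assumes "y \<in> span (v ` {..k})"
  shows "ev v k * (norm y)\<^sup>2 \<le> W y \<bullet> y"
proof -
  have y: "y = (\<Sum>j\<le>k. (y \<bullet> v j) *\<^sub>R v j)"
    using orthonormal_seq_expand_span[OF eigensystem_orthonormal _ assms] by simp
  have "(norm y)\<^sup>2 = y \<bullet> y" by (simp add: power2_norm_eq_inner)
  also have "\<dots> = y \<bullet> (\<Sum>j\<le>k. (y \<bullet> v j) *\<^sub>R v j)" using y by simp
  also have "\<dots> = (\<Sum>j\<le>k. (y \<bullet> v j)\<^sup>2)" by (simp add: inner_sum_right power2_eq_square)
  finally have "ev v k * (norm y)\<^sup>2 = (\<Sum>j\<le>k. ev v k * (y \<bullet> v j)\<^sup>2)"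
    by (simp add: sum_distrib_left)
  also have "\<dots> \<le> (\<Sum>j\<le>k. ev v j * (y \<bullet> v j)\<^sup>2)"
    using ev_antimono by (intro sum_mono mult_right_mono) (auto dest: antimonoD)
  also have "\<dots> = W y \<bullet> (\<Sum>j\<le>k. (y \<bullet> v j) *\<^sub>R v j)"
    by (simp add: inner_sum_right symmetric eigensystem_eq power2_eq_square algebra_simps)
  also have "\<dots> = W y \<bullet> y" using y by simp
  finally show ?thesis .
qed

text \<open>Otherwise monotonicity gives \<open>t \<le> ev v k\<close> for all \<open>k\<close>. The
  images \<open>W (v k)\<close> are then pairwise orthogonal and at distance at least
  \<open>t\<close> from each other, so no subsequence of them is Cauchy, against
  compactness.\<close>

lemma finite_ev_ge:
  assumes "0 < t"
  shows "finite {k. t \<le> ev v k}"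
proof (rule ccontr)
  assume inf: "infinite {k. t \<le> ev v k}"
  have ge: "t \<le> ev v k" for k
  proof -
    obtain j where "k \<le> j" "t \<le> ev v j" using inf by (auto simp: infinite_nat_iff_unbounded_le)
    then show ?thesis using antimonoD[OF ev_antimono \<open>k \<le> j\<close>] by linarith
  qed
  have "bounded (range v)"
    using orthonormal_seq_norm[OF eigensystem_orthonormal] by (auto simp: bounded_iff intro!: exI[of _ 1])
  then obtain r where r: "strict_mono r" and "convergent (W \<circ> v \<circ> r)" using compact by blast
  then have "Cauchy (W \<circ> v \<circ> r)" by (simp add: convergent_Cauchy)
  then obtain N where N: "\<And>m n. m \<ge> N \<Longrightarrow> n \<ge> N \<Longrightarrow> dist (W (v (r m))) (W (v (r n))) < t"
    using assms unfolding Cauchy_def o_def by meson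
  have "r (Suc N) \<noteq> r N" using r by (metis less_irrefl lessI strict_mono_less)
  then have orth: "v (r (Suc N)) \<bullet> v (r N) = 0" "v (r N) \<bullet> v (r (Suc N)) = 0"
    and nrm: "\<And>i. v i \<bullet> v i = 1"
    using eigensystem_orthonormal by (auto simp: orthonormal_seq_def)
  have "t\<^sup>2 \<le> (ev v (r N))\<^sup>2" using ge assms by (intro power_mono) auto
  also have "\<dots> \<le> (ev v (r (Suc N)))\<^sup>2 + (ev v (r N))\<^sup>2" by simp
  also have "\<dots> = (norm (W (v (r (Suc N))) - W (v (r N))))\<^sup>2"
    unfolding power2_norm_eq_inner
    by (simp add: eigensystem_eq inner_diff_left inner_diff_right orth nrm power2_eq_square)
  also have "\<dots> < t\<^sup>2"
    using N[of "Suc N" N] by (intro power_strict_mono) (auto simp: dist_norm)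
  finally show False by simp
qed

lemma finite_ev_eq: "l \<noteq> 0 \<Longrightarrow> finite {k. ev v k = l}"
proof (cases "0 < l")
  case True
  then show ?thesis by (rule finite_subset[rotated, OF finite_ev_ge]) auto
next
  case False
  assume "l \<noteq> 0"
  then have "{k. ev v k = l} = {}" using False ev_nonneg by (smt (verit) empty_iff mem_Collect_eq equals0I)
  then show ?thesis by simp
qed

text \<open>An eigenvector \<open>x\<close> for \<open>l\<close> is orthogonal to every
  \<open>v k\<close> with another eigenvalue. Subtracting its projection \<open>s\<close> leaves a
  vector orthogonal to all \<open>v k\<close>; were it nonzero, the form bound would give
  \<open>l \<le> ev v k\<close> for all \<open>k\<close>, contradicting \<open>finite_ev_ge\<close>.
  For \<open>l = 0\<close> the kernel can be larger than the span.\<close>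

lemma eigenspace_eq_span:
  assumes "l \<noteq> 0"
  shows "{x. W x = l *\<^sub>R x} = span (v ` {k. ev v k = l})"
proof (intro equalityI subsetI CollectI)
  let ?S = "{k. ev v k = l}"
  fix x assume "x \<in> {x. W x = l *\<^sub>R x}"
  then have x: "W x = l *\<^sub>R x" by simp
  have fin: "finite ?S" by (rule finite_ev_eq[OF assms])
  have perp: "x \<bullet> v k = 0" if "ev v k \<noteq> l" for k
    using symmetric[of x "v k"] that by (simp add: x eigensystem_eq)
  define s where "s = (\<Sum>k\<in>?S. (x \<bullet> v k) *\<^sub>R v k)"
  have sv: "s \<bullet> v k = (if k \<in> ?S then x \<bullet> v k else 0)" for k
    unfolding s_def by (rule orthonormal_seq_sum_inner[OF eigensystem_orthonormal fin])
  have "(x - s) \<bullet> v k = 0" for k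
    by (simp add: inner_diff_left sv perp)
  then have le: "W (x - s) \<bullet> (x - s) \<le> ev v k * (norm (x - s))\<^sup>2" for k
    by (intro eigensystem_le)
  have "x - s = 0"
  proof (rule ccontr)
    assume ne: "x - s \<noteq> 0"
    have "W (x - s) = l *\<^sub>R (x - s)"
      by (simp add: s_def diff sum scale x eigensystem_eq scaleR_diff_right scaleR_sum_right mult.commute)
    then have "l * (norm (x - s))\<^sup>2 \<le> ev v k * (norm (x - s))\<^sup>2" for k
      using le[of k] by (simp add: power2_norm_eq_inner)
    then have "l \<le> ev v k" for k using ne by simp
    moreover have "l > 0"
      using psd[of "x - s"] \<open>W (x - s) = l *\<^sub>R (x - s)\<close> ne assms
      by (simp add: zero_le_mult_iff) (metis inner_gt_zero_iff le_less not_less ne)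
    ultimately show False using finite_ev_ge[of l] by simp
  qed
  then have "x = s" by simp
  also have "s \<in> span (v ` ?S)" unfolding s_def by (blast intro: span_sum span_scale span_base imageI)
  finally show "x \<in> span (v ` ?S)" .
next
  fix x assume "x \<in> span (v ` {k. ev v k = l})"
  then show "W x = l *\<^sub>R x"
  proof (induction rule: span_induct)
    case base
    show ?case by (auto simp: subspace_def zero add scale scaleR_add_right)
  next
    case (step x)
    then show ?case by (auto simp: eigensystem_eq)
  qed
qed

section \<open>Agreement with the descending listing of eigenvalues\<close>

lemma eigenvalue_listing_ev: "eigenvalue_listing W (ev v)"
  unfolding eigenvalue_listing_def
proof (intro conjI allI impI ev_antimono)
  fix k
  have "v k \<noteq> 0" using orthonormal_seq_norm[OF eigensystem_orthonormal, of k] by auto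
  then show "eigenvalue W (ev v k)" using eigensystem_eq by (auto simp: eigenvalue_def)
next
  fix l :: real assume l: "l \<noteq> 0"
  then show "finite {k. ev v k = l}" by (rule finite_ev_eq)
  show "card {k. ev v k = l} = dim {x. W x = l *\<^sub>R x}"
    using dim_span_eq_card_independent[OF orthonormal_seq_independent[OF eigensystem_orthonormal]]
      orthonormal_seq_card[OF eigensystem_orthonormal]
    by (simp only: eigenspace_eq_span[OF l])
qed

text \<open>A nonnegative sequence is determined by its superlevel sets at levels
  \<open>t > 0\<close>. For nonincreasing sequences these sets are nested, so equal finite
  cardinality makes them equal; the cardinality is a sum of multiplicities over the finitely many
  values at or above \<open>t\<close>. Staying at \<open>t > 0\<close> avoids the value 0, whose
  count is not prescribed.\<close>

lemma eigenvalue_listing_unique: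
  assumes m: "eigenvalue_listing W m"
  shows "m = ev v"
proof
  note e = eigenvalue_listing_ev
  have card_eq: "card {k. m k = l} = card {k. ev v k = l}" "finite {k. m k = l}" if "l \<noteq> 0" for l
    using m e that by (auto simp: eigenvalue_listing_def)
  have range: "l \<in> range m \<longleftrightarrow> l \<in> range (ev v)" if "l \<noteq> 0" for l
  proof -
    have "l \<in> range f \<longleftrightarrow> card {k. f k = l} \<noteq> 0" if "finite {k. f k = l}" for f :: "nat \<Rightarrow> real"
      using that by auto
    from this[of m] this[of "ev v"] show ?thesis using card_eq[OF that] finite_ev_eq[OF that] by metis
  qed
  have nonneg: "0 \<le> m k" for k
    using range[of "m k"] ev_nonneg by (metis imageE rangeI order_refl)
  have sets: "{k. t \<le> m k} = {k. t \<le> ev v k}" if t: "0 < t" for t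
  proof -
    define L where "L = ev v ` {k. t \<le> ev v k}"
    have L: "finite L" "\<And>l. l \<in> L \<Longrightarrow> l \<noteq> 0" "\<And>l. l \<in> L \<Longrightarrow> t \<le> l"
      using finite_ev_ge[OF t] t by (auto simp: L_def)
    have ev_U: "{k. t \<le> ev v k} = (\<Union>l\<in>L. {k. ev v k = l})" by (auto simp: L_def)
    have m_U: "{k. t \<le> m k} = (\<Union>l\<in>L. {k. m k = l})"
    proof (intro equalityI subsetI)
      fix k assume "k \<in> {k. t \<le> m k}"
      then have "t \<le> m k" by simp
      then have "m k \<in> range (ev v)" using range[of "m k"] t by auto
      then have "m k \<in> L" using \<open>t \<le> m k\<close> by (auto simp: L_def)
      then show "k \<in> (\<Union>l\<in>L. {k. m k = l})" by auto
    qed (use L in auto)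
    have fin: "finite {k. t \<le> m k}" "finite {k. t \<le> ev v k}"
      unfolding m_U using L card_eq finite_ev_ge[OF t] by auto
    have "card {k. t \<le> m k} = (\<Sum>l\<in>L. card {k. m k = l})"
      unfolding m_U using L card_eq by (intro card_UN_disjoint) auto
    also have "\<dots> = (\<Sum>l\<in>L. card {k. ev v k = l})"
      using L card_eq by (intro sum.cong) auto
    also have "\<dots> = card {k. t \<le> ev v k}"
      unfolding ev_U using L finite_ev_eq by (intro card_UN_disjoint[symmetric]) auto
    finally have cards: "card {k. t \<le> m k} = card {k. t \<le> ev v k}" .
    have "{k. t \<le> m k} \<subseteq> {k. t \<le> ev v k} \<or> {k. t \<le> ev v k} \<subseteq> {k. t \<le> m k}"
    proof -
      have "antimono m" using m by (simp add: eigenvalue_listing_def)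
      then have "j \<le> k \<Longrightarrow> m k \<le> m j" "j \<le> k \<Longrightarrow> ev v k \<le> ev v j" for j k
        using ev_antimono by (auto dest: antimonoD)
      then show ?thesis by (smt (verit) Collect_mono mem_Collect_eq nat_le_linear subsetI)
    qed
    then show ?thesis using cards fin by (metis card_subset_eq)
  qed
  have "t \<le> m k \<longleftrightarrow> t \<le> ev v k" if "0 < t" for t k using sets[OF that] by blast
  from this[of "m k" k for k] this[of "ev v k" k for k]
  show "m k = ev v k" for k
    using nonneg[of k] ev_nonneg[of k] by (metis order.antisym order.order_iff_strict order_refl)
qed

text \<open>Any eigensystem may stand in for the definite description in \<open>mu\<close>. The
  shift matches the numbering of \<open>mu\<close> from 1; truncated subtraction makes
  \<open>mu W 0\<close> equal to \<open>mu W 1\<close>.\<close>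

lemma mu_eq_ev: "mu W k = ev v (k - 1)"
  unfolding mu_def using eigenvalue_listing_ev eigenvalue_listing_unique
  by (metis the_equality)

end

end

text \<open>Some unit vector in the span of the first \<open>k + 1\<close> vectors of
  \<open>v\<close> is orthogonal to the first \<open>k\<close> vectors of \<open>w\<close>. At this
  vector the form of \<open>W\<close> is at least \<open>ev v k\<close> and that of \<open>V\<close>
  at most \<open>ev w k\<close>.\<close>

lemma eigenvalue_le_perturbed:
  assumes "compact_psd_operator W" "compact_psd_operator V"
    and vw: "compact_psd_operator.eigensystem W v" "compact_psd_operator.eigensystem V w"
    and close: "\<And>x. W x \<bullet> x \<le> V x \<bullet> x + d * (norm x)\<^sup>2"
  shows "compact_psd_operator.ev W v k \<le> compact_psd_operator.ev V w k + d"
proof -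
  interpret W: compact_psd_operator W by fact
  interpret V: compact_psd_operator V by fact
  note ov = W.eigensystem_orthonormal[OF vw(1)]
  obtain x where x: "x \<in> span (v ` {..k})" "norm x = 1" "\<And>i. i < k \<Longrightarrow> x \<bullet> w i = 0"
    using span_orthogonal_to_fewer_vectors[of "v ` {..k}" k w]
      orthonormal_seq_independent[OF ov] orthonormal_seq_card[OF ov] by auto
  have "W.ev v k \<le> W x \<bullet> x" using W.form_span_ge[OF vw(1) x(1)] x(2) by simp
  also have "\<dots> \<le> V x \<bullet> x + d" using close[of x] x(2) by simp
  also have "\<dots> \<le> V.ev w k + d" using V.eigensystem_le[OF vw(2) x(3)] x(2) by simp
  finally show ?thesis .
qed

section \<open>Sign, order and Lipschitz dependence of the eigenvalues \<open>mu\<close>\<close>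

context
  fixes e :: "nat \<Rightarrow> 'a::real_inner"
  assumes e: "orthonormal_seq e"
begin

lemma mu_nonneg:
  assumes "compact_psd_operator (W :: 'a \<Rightarrow> 'a)"
  shows "0 \<le> mu W k"
  using compact_psd_operator.eigensystem_exists[OF assms e] compact_psd_operator.ev_nonneg[OF assms]
    compact_psd_operator.mu_eq_ev[OF assms] by metis

lemma mu_antimono:
  assumes "compact_psd_operator (W :: 'a \<Rightarrow> 'a)" "j \<le> k"
  shows "mu W k \<le> mu W j"
proof -
  interpret compact_psd_operator W by fact
  obtain v where v: "eigensystem v" using eigensystem_exists[OF e] by blast
  show ?thesis using antimonoD[OF ev_antimono[OF v]] assms(2) by (simp add: mu_eq_ev[OF v])
qed

theorem Weyl_perturbation:
  assumes W: "compact_psd_operator (W :: 'a \<Rightarrow> 'a)" and V: "compact_psd_operator V"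
    and close: "\<And>x. \<bar>W x \<bullet> x - V x \<bullet> x\<bar> \<le> d * (norm x)\<^sup>2"
  shows "\<bar>mu W k - mu V k\<bar> \<le> d"
proof -
  obtain v w where vw: "compact_psd_operator.eigensystem W v" "compact_psd_operator.eigensystem V w"
    using compact_psd_operator.eigensystem_exists[OF W e] compact_psd_operator.eigensystem_exists[OF V e]
    by metis
  have "W x \<bullet> x \<le> V x \<bullet> x + d * (norm x)\<^sup>2" "V x \<bullet> x \<le> W x \<bullet> x + d * (norm x)\<^sup>2" for x
    using close[of x] by auto
  then show ?thesis
    using eigenvalue_le_perturbed[OF W V vw] eigenvalue_le_perturbed[OF V W vw(2,1)]
    by (simp add: abs_le_iff compact_psd_operator.mu_eq_ev[OF W vw(1)]
        compact_psd_operator.mu_eq_ev[OF V vw(2)] algebra_simps)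
qed

end

section \<open>Orthonormal expansions and Hilbert-Schmidt operators\<close>

lemma orthonormal_seq_norm_sum:
  assumes "orthonormal_seq e" "finite S"
  shows "(norm (\<Sum>i\<in>S. c i *\<^sub>R e i))\<^sup>2 = (\<Sum>i\<in>S. (c i)\<^sup>2)"
proof -
  have "(norm (\<Sum>i\<in>S. c i *\<^sub>R e i))\<^sup>2 = (\<Sum>j\<in>S. c j * ((\<Sum>i\<in>S. c i *\<^sub>R e i) \<bullet> e j))"
    by (simp add: power2_norm_eq_inner inner_sum_right)
  then show ?thesis
    by (simp add: orthonormal_seq_sum_inner[OF assms] power2_eq_square cong: sum.cong)
qed

lemma orthonormal_seq_norm_residual:
  assumes "orthonormal_seq e" "finite S"
  shows "(norm (x - (\<Sum>i\<in>S. (x \<bullet> e i) *\<^sub>R e i)))\<^sup>2 = (norm x)\<^sup>2 - (\<Sum>i\<in>S. (x \<bullet> e i)\<^sup>2)"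
proof -
  let ?s = "\<Sum>i\<in>S. (x \<bullet> e i) *\<^sub>R e i"
  have "x \<bullet> ?s = (\<Sum>i\<in>S. (x \<bullet> e i)\<^sup>2)" by (simp add: inner_sum_right power2_eq_square)
  moreover have "(norm (x - ?s))\<^sup>2 = (norm x)\<^sup>2 - 2 * (x \<bullet> ?s) + (norm ?s)\<^sup>2"
    unfolding power2_norm_eq_inner by (simp add: inner_diff_left inner_diff_right inner_commute)
  ultimately show ?thesis by (simp add: orthonormal_seq_norm_sum[OF assms])
qed

lemma Bessel_inequality:
  assumes "orthonormal_seq e" "finite S"
  shows "(\<Sum>i\<in>S. (x \<bullet> e i)\<^sup>2) \<le> (norm x)\<^sup>2"
proof -
  have "0 \<le> (norm (x - (\<Sum>i\<in>S. (x \<bullet> e i) *\<^sub>R e i)))\<^sup>2" by simp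
  then show ?thesis unfolding orthonormal_seq_norm_residual[OF assms] by simp
qed

lemma orthonormal_seq_residual_le:
  assumes "orthonormal_seq e" "finite S"
  shows "norm (x - (\<Sum>i\<in>S. (x \<bullet> e i) *\<^sub>R e i)) \<le> norm x"
proof (rule power2_le_imp_le)
  show "(norm (x - (\<Sum>i\<in>S. (x \<bullet> e i) *\<^sub>R e i)))\<^sup>2 \<le> (norm x)\<^sup>2"
    unfolding orthonormal_seq_norm_residual[OF assms] by (simp add: sum_nonneg)
qed simp

text \<open>Riesz-Fischer: by Pythagoras the squared norm of a block of the vector series is the
  corresponding block of the series of squares, so the Cauchy criterion carries over.\<close>

lemma summable_orthonormal_seq:
  fixes e :: "nat \<Rightarrow> 'a::{real_inner, banach}"
  assumes e: "orthonormal_seq e" and c: "summable (\<lambda>i. (c i)\<^sup>2)"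
  shows "summable (\<lambda>i. c i *\<^sub>R e i)"
  unfolding summable_Cauchy
proof (intro allI impI)
  fix \<epsilon> :: real assume "\<epsilon> > 0"
  then obtain N where N: "\<And>m n. m \<ge> N \<Longrightarrow> norm (\<Sum>i\<in>{m..<n}. (c i)\<^sup>2) < \<epsilon>\<^sup>2"
    using c unfolding summable_Cauchy by (meson zero_less_power)
  have "norm (\<Sum>i\<in>{m..<n}. c i *\<^sub>R e i) < \<epsilon>" if "m \<ge> N" for m n
  proof (rule power2_less_imp_less)
    show "(norm (\<Sum>i\<in>{m..<n}. c i *\<^sub>R e i))\<^sup>2 < \<epsilon>\<^sup>2"
      using N[OF that, of n] by (simp add: orthonormal_seq_norm_sum[OF e])
  qed (use \<open>\<epsilon> > 0\<close> in simp)
  then show "\<exists>N. \<forall>m\<ge>N. \<forall>n. norm (\<Sum>i\<in>{m..<n}. c i *\<^sub>R e i) < \<epsilon>" by blast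
qed

section \<open>Complete systems: expansions, adjoints and diagonal operators\<close>

lemma complete_orthonormal_system_seq: "complete_orthonormal_system e \<Longrightarrow> orthonormal_seq e"
  by (simp add: complete_orthonormal_system_def orthonormal_seq_def)

lemma span_range_nat_finite:
  fixes e :: "nat \<Rightarrow> 'a::real_vector"
  assumes "y \<in> span (range e)"
  shows "\<exists>N. \<forall>n\<ge>N. y \<in> span (e ` {..<n})"
  using assms
proof (induction rule: span_induct)
  case base
  show ?case
  proof (rule subspaceI)
    fix x y assume "x \<in> {x. \<exists>N. \<forall>n\<ge>N. x \<in> span (e ` {..<n})}" "y \<in> {x. \<exists>N. \<forall>n\<ge>N. x \<in> span (e ` {..<n})}"
    then obtain M N where "\<forall>n\<ge>M. x \<in> span (e ` {..<n})" "\<forall>n\<ge>N. y \<in> span (e ` {..<n})" by blast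
    then show "x + y \<in> {x. \<exists>N. \<forall>n\<ge>N. x \<in> span (e ` {..<n})}"
      by (auto intro!: exI[of _ "max M N"] span_add)
  qed (auto intro: span_zero span_scale)
next
  case (step x)
  then obtain i where "x = e i" by auto
  then show ?case by (intro exI[of _ "Suc i"]) (auto intro!: span_base)
qed

text \<open>A nearby \<open>y\<close> in the span equals its own partial sums from some index on.
  From there the residual of \<open>x\<close> is the residual of \<open>x - y\<close>, whose norm is
  at most \<open>norm (x - y)\<close>.\<close>

lemma complete_orthonormal_system_expansion:
  assumes "complete_orthonormal_system e"
  shows "(\<lambda>i. (x \<bullet> e i) *\<^sub>R e i) sums x"
  unfolding sums_def tendsto_iff
proof (intro allI impI)
  note e = complete_orthonormal_system_seq[OF assms]
  fix \<epsilon> :: real assume "\<epsilon> > 0"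
  moreover have "x \<in> closure (span (range e))"
    using assms by (simp add: complete_orthonormal_system_def)
  ultimately obtain y where y: "y \<in> span (range e)" "dist y x < \<epsilon>"
    by (auto simp: closure_approachable)
  then obtain N where N: "\<And>n. n \<ge> N \<Longrightarrow> y \<in> span (e ` {..<n})"
    using span_range_nat_finite by blast
  have "dist (\<Sum>i<n. (x \<bullet> e i) *\<^sub>R e i) x < \<epsilon>" if "n \<ge> N" for n
  proof -
    have "y = (\<Sum>i<n. (y \<bullet> e i) *\<^sub>R e i)"
      by (rule orthonormal_seq_expand_span[OF e _ N[OF that]]) simp
    then have eq: "x - (\<Sum>i<n. (x \<bullet> e i) *\<^sub>R e i) = (x - y) - (\<Sum>i<n. ((x - y) \<bullet> e i) *\<^sub>R e i)"
      by (simp add: inner_diff_left scaleR_diff_left sum_subtractf)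
    have "norm (x - (\<Sum>i<n. (x \<bullet> e i) *\<^sub>R e i)) \<le> norm (x - y)"
      unfolding eq by (rule orthonormal_seq_residual_le[OF e]) simp
    then show ?thesis using y(2) by (simp add: dist_norm norm_minus_commute)
  qed
  then show "\<forall>\<^sub>F n in sequentially. dist (\<Sum>i<n. (x \<bullet> e i) *\<^sub>R e i) x < \<epsilon>"
    by (auto simp: eventually_sequentially)
qed

lemma bounded_linear_expansion:
  assumes "complete_orthonormal_system e" "bounded_linear f"
  shows "(\<lambda>i. (x \<bullet> e i) *\<^sub>R f (e i)) sums f x"
  using bounded_linear.sums[OF assms(2) complete_orthonormal_system_expansion[OF assms(1), of x]]
  unfolding linear_cmul[OF bounded_linear.linear[OF assms(2)]] .

text \<open>The Riesz representative of \<open>x \<mapsto> \<langle>f x, y\<rangle>\<close> has the coefficients \<open>\<langle>f e\<^sub>i, y\<rangle>\<close>.\<close>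

lemma adjoint_bounded_linear:
  fixes e :: "nat \<Rightarrow> 'a::{real_inner, banach}" and f :: "'a \<Rightarrow> 'a"
  assumes e: "complete_orthonormal_system e" and f: "bounded_linear f"
  shows "f x \<bullet> y = x \<bullet> adjoint f y"
proof -
  note oe = complete_orthonormal_system_seq[OF e]
  have "\<exists>z. \<forall>x. f x \<bullet> y = x \<bullet> z" for y
  proof -
    define c where "c i = f (e i) \<bullet> y" for i
    obtain K where K: "\<And>x. norm (f x) \<le> norm x * K" "K > 0"
      using bounded_linear.pos_bounded[OF f] by blast
    have "(\<Sum>i<n. (c i)\<^sup>2) \<le> (K * norm y)\<^sup>2" for n
    proof -
      \<comment> \<open>Testing \<open>f\<close> against the partial sum \<open>s\<close> itself
        gives \<open>(norm s)\<^sup>2 = f s \<bullet> y\<close>, and one factor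
        \<open>norm s\<close> cancels.\<close>
      define s where "s = (\<Sum>i<n. c i *\<^sub>R e i)"
      have ss: "(norm s)\<^sup>2 = (\<Sum>i<n. (c i)\<^sup>2)"
        unfolding s_def by (rule orthonormal_seq_norm_sum[OF oe]) simp
      also have "\<dots> = f s \<bullet> y"
        using bounded_linear.linear[OF f]
        by (simp add: s_def linear_sum linear_cmul inner_sum_left c_def power2_eq_square)
      also have "\<dots> \<le> norm (f s) * norm y" by (rule norm_cauchy_schwarz)
      also have "\<dots> \<le> (norm s * K) * norm y" using K by (intro mult_right_mono) auto
      finally have "norm s * norm s \<le> norm s * (K * norm y)" by (simp add: power2_eq_square mult_ac)
      then have "norm s \<le> K * norm y"
        using K(2) by (cases "norm s = 0") auto
      then show ?thesis using ss by (metis norm_ge_zero power_mono)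
    qed
    then have "summable (\<lambda>i. (c i)\<^sup>2)" by (intro summableI_nonneg_bounded) auto
    then have "summable (\<lambda>i. c i *\<^sub>R e i)" by (rule summable_orthonormal_seq[OF oe])
    then have s: "(\<lambda>i. c i *\<^sub>R e i) sums (\<Sum>i. c i *\<^sub>R e i)" by (rule summable_sums)
    have "f x \<bullet> y = x \<bullet> (\<Sum>i. c i *\<^sub>R e i)" for x
    proof (rule sums_unique2)
      show "(\<lambda>i. (x \<bullet> e i) * c i) sums (f x \<bullet> y)"
        using bounded_linear.sums[OF bounded_linear_inner_left bounded_linear_expansion[OF e f, of x], of y]
        by (simp add: c_def)
      show "(\<lambda>i. (x \<bullet> e i) * c i) sums (x \<bullet> (\<Sum>i. c i *\<^sub>R e i))"
        using bounded_linear.sums[OF bounded_linear_inner_right s, of x] by (simp add: mult.commute)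
    qed
    then show ?thesis by blast
  qed
  then have "\<exists>g. \<forall>x y. f x \<bullet> y = x \<bullet> g y" by metis
  \<comment> \<open>\<open>adjoint\<close> is defined by choice, so the existence of some
    \<open>g\<close> yields its property.\<close>
  then have "\<forall>x y. f x \<bullet> y = x \<bullet> adjoint f y" unfolding adjoint_def by (rule someI_ex)
  then show ?thesis by blast
qed

text \<open>The definite description in \<open>input_op\<close> has to be justified. Existence: the
  diagonal series converges by Riesz-Fischer and its norm is at most \<open>sqrt C\<close> times
  that of \<open>x\<close>. Uniqueness: a bounded operator is determined by its values on
  \<open>e\<close>.\<close>

lemma input_op_apply:
  fixes e :: "nat \<Rightarrow> 'a::{real_inner, banach}"
  assumes e: "complete_orthonormal_system e" and p: "\<And>i. 0 \<le> p i" "\<And>i. p i \<le> C"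
  shows "blinfun_apply (input_op e p) (e i) = sqrt (p i) *\<^sub>R e i"
proof -
  note oe = complete_orthonormal_system_seq[OF e]
  have C: "0 \<le> C" using p order_trans by blast
  define f where "f x = (\<Sum>i. (sqrt (p i) * (x \<bullet> e i)) *\<^sub>R e i)" for x
  have le: "(\<Sum>i<n. (sqrt (p i) * (x \<bullet> e i))\<^sup>2) \<le> C * (norm x)\<^sup>2" for n x
  proof -
    have "(\<Sum>i<n. (sqrt (p i) * (x \<bullet> e i))\<^sup>2) \<le> (\<Sum>i<n. C * (x \<bullet> e i)\<^sup>2)"
      using p by (intro sum_mono) (auto simp: power_mult_distrib intro: mult_right_mono)
    also have "\<dots> \<le> C * (norm x)\<^sup>2"
      using Bessel_inequality[OF oe, of "{..<n}" x] C by (simp add: mult_left_mono flip: sum_distrib_left)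
    finally show ?thesis .
  qed
  have f: "(\<lambda>i. (sqrt (p i) * (x \<bullet> e i)) *\<^sub>R e i) sums f x" for x
    unfolding f_def using le
    by (intro summable_sums summable_orthonormal_seq[OF oe] summableI_nonneg_bounded) auto
  have "norm (f x) \<le> norm x * sqrt C" for x
  proof (rule LIMSEQ_le_const2)
    show "(\<lambda>n. norm (\<Sum>i<n. (sqrt (p i) * (x \<bullet> e i)) *\<^sub>R e i)) \<longlonglongrightarrow> norm (f x)"
      using f[of x] unfolding sums_def by (rule tendsto_norm)
    have "norm (\<Sum>i<n. (sqrt (p i) * (x \<bullet> e i)) *\<^sub>R e i) \<le> norm x * sqrt C" for n
    proof (rule power2_le_imp_le)
      have "(norm (\<Sum>i<n. (sqrt (p i) * (x \<bullet> e i)) *\<^sub>R e i))\<^sup>2 \<le> C * (norm x)\<^sup>2"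
        using le[of x n] by (simp only: orthonormal_seq_norm_sum[OF oe finite_lessThan])
      then show "(norm (\<Sum>i<n. (sqrt (p i) * (x \<bullet> e i)) *\<^sub>R e i))\<^sup>2 \<le> (norm x * sqrt C)\<^sup>2"
        using C by (simp add: power_mult_distrib[of "norm x"] mult.commute[of C])
    qed (use C in simp)
    then show "\<exists>N. \<forall>n\<ge>N. norm (\<Sum>i<n. (sqrt (p i) * (x \<bullet> e i)) *\<^sub>R e i) \<le> norm x * sqrt C"
      by blast
  qed
  moreover have "f (x + y) = f x + f y" for x y
    using sums_unique2[OF f[of "x + y"]] sums_add[OF f[of x] f[of y]]
    by (simp add: inner_add_left distrib_left scaleR_add_left)
  moreover have "f (r *\<^sub>R x) = r *\<^sub>R f x" for r x
    using sums_unique2[OF f[of "r *\<^sub>R x"]] sums_scaleR_right[OF f[of x], of r] by (simp add: mult_ac)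
  ultimately have bl: "bounded_linear f" by (intro bounded_linear_intro)
  have fe: "f (e j) = sqrt (p j) *\<^sub>R e j" for j
  proof -
    have "f (e j) = (\<Sum>i. if i = j then sqrt (p i) *\<^sub>R e i else 0)"
      unfolding f_def by (intro suminf_cong) (simp add: orthonormal_seq_inner[OF oe])
    also have "\<dots> = sqrt (p j) *\<^sub>R e j"
      using sums_single[of j "\<lambda>i. sqrt (p i) *\<^sub>R e i"] by (simp add: sums_iff)
    finally show ?thesis .
  qed
  have "\<exists>!B. \<forall>i. blinfun_apply B (e i) = sqrt (p i) *\<^sub>R e i"
  proof (rule ex1I)
    show "\<forall>i. blinfun_apply (Blinfun f) (e i) = sqrt (p i) *\<^sub>R e i"
      by (simp add: bounded_linear_Blinfun_apply[OF bl] fe)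
    fix B assume B: "\<forall>i. blinfun_apply B (e i) = sqrt (p i) *\<^sub>R e i"
    show "B = Blinfun f"
    proof (rule blinfun_eqI)
      fix x
      have "(\<lambda>i. (x \<bullet> e i) *\<^sub>R f (e i)) sums blinfun_apply B x"
        using bounded_linear_expansion[OF e blinfun.bounded_linear_right, of x B] B fe by simp
      then show "blinfun_apply B x = blinfun_apply (Blinfun f) x"
        using sums_unique2 bounded_linear_expansion[OF e bl, of x]
        by (metis bounded_linear_Blinfun_apply[OF bl])
    qed
  qed
  from theI'[OF this] show ?thesis unfolding input_op_def by blast
qed

text \<open>The difference is the tail of the expansion of \<open>W x\<close>. Cauchy-Schwarz for
  finite sums splits it into the coefficients of \<open>x\<close>, controlled by Bessel, and the
  Hilbert-Schmidt tail.\<close>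

lemma Hilbert_Schmidt_tail:
  fixes W :: "'a::real_inner \<Rightarrow> 'a"
  assumes e: "complete_orthonormal_system e" and W: "bounded_linear W"
    and h: "summable (\<lambda>j. (norm (W (e j)))\<^sup>2)"
  shows "norm (W x - (\<Sum>j<N. (x \<bullet> e j) *\<^sub>R W (e j))) \<le> norm x * sqrt (\<Sum>j. (norm (W (e (j + N))))\<^sup>2)"
proof (rule LIMSEQ_le_const2)
  note oe = complete_orthonormal_system_seq[OF e]
  show "(\<lambda>n. norm (\<Sum>j<n. (x \<bullet> e (j + N)) *\<^sub>R W (e (j + N))))
          \<longlonglongrightarrow> norm (W x - (\<Sum>j<N. (x \<bullet> e j) *\<^sub>R W (e j)))"
    using sums_split_initial_segment[OF bounded_linear_expansion[OF e W, of x], of N]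
    unfolding sums_def by (rule tendsto_norm)
  have "norm (\<Sum>j<n. (x \<bullet> e (j + N)) *\<^sub>R W (e (j + N))) \<le> norm x * sqrt (\<Sum>j. (norm (W (e (j + N))))\<^sup>2)" for n
  proof -
    have "norm (\<Sum>j<n. (x \<bullet> e (j + N)) *\<^sub>R W (e (j + N))) \<le> (\<Sum>j<n. \<bar>x \<bullet> e (j + N)\<bar> * \<bar>norm (W (e (j + N)))\<bar>)"
      by (rule sum_norm_le) simp
    also have "\<dots> \<le> L2_set (\<lambda>j. x \<bullet> e (j + N)) {..<n} * L2_set (\<lambda>j. norm (W (e (j + N)))) {..<n}"
      by (rule L2_set_mult_ineq)
    also have "\<dots> \<le> norm x * sqrt (\<Sum>j. (norm (W (e (j + N))))\<^sup>2)"
    proof (rule mult_mono)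
      have "(\<Sum>j<n. (x \<bullet> e (j + N))\<^sup>2) = (\<Sum>j\<in>(\<lambda>j. j + N) ` {..<n}. (x \<bullet> e j)\<^sup>2)"
        by (simp add: sum.reindex)
      also have "\<dots> \<le> (norm x)\<^sup>2" by (rule Bessel_inequality[OF oe]) simp
      finally show "L2_set (\<lambda>j. x \<bullet> e (j + N)) {..<n} \<le> norm x"
        by (simp add: L2_set_def real_le_lsqrt)
      have "summable (\<lambda>j. (norm (W (e (j + N))))\<^sup>2)" using h by (rule summable_ignore_initial_segment)
      then show "L2_set (\<lambda>j. norm (W (e (j + N)))) {..<n} \<le> sqrt (\<Sum>j. (norm (W (e (j + N))))\<^sup>2)"
        by (simp add: L2_set_def sum_le_suminf)
    qed (auto simp: L2_set_nonneg)
    finally show ?thesis .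
  qed
  then show "\<exists>M. \<forall>n\<ge>M. norm (\<Sum>j<n. (x \<bullet> e (j + N)) *\<^sub>R W (e (j + N))) \<le> norm x * sqrt (\<Sum>j. (norm (W (e (j + N))))\<^sup>2)"
    by blast
qed

text \<open>Tychonoff in place of a diagonal argument: the box of intervals
  \<open>{- B j..B j}\<close> is compact, hence sequentially compact, in the product
  topology.\<close>

lemma coordinatewise_convergent_subsequence:
  fixes c :: "nat \<Rightarrow> nat \<Rightarrow> real"
  assumes "\<And>n j. \<bar>c n j\<bar> \<le> B j"
  obtains r where "strict_mono r" "\<And>j. convergent (\<lambda>n. c (r n) j)"
proof -
  have "compactin (product_topology (\<lambda>_. euclidean) UNIV) (PiE UNIV (\<lambda>j. {- B j..B j}))"
    unfolding compactin_PiE by simp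
  then have "compact (PiE UNIV (\<lambda>j. {- B j..B j}))"
    by (simp add: euclidean_product_topology)
  then have "seq_compact (PiE UNIV (\<lambda>j. {- B j..B j}))" by (rule compact_imp_seq_compact)
  moreover have "\<forall>n. c n \<in> PiE UNIV (\<lambda>j. {- B j..B j})"
    using assms by (auto simp: PiE_UNIV_domain abs_le_iff) (metis minus_le_iff)
  ultimately obtain l r where r: "strict_mono r" "(c \<circ> r) \<longlonglongrightarrow> l"
    by (meson seq_compactE)
  have "(\<lambda>n. c (r n) j) \<longlonglongrightarrow> l j" for j
    using continuous_on_tendsto_compose[OF continuous_on_product_coordinates r(2), of j] by (simp add: o_def)
  then show thesis using r(1) by (intro that[of r]) (auto simp: convergent_def)
qed

text \<open>Along a subsequence all coordinates of \<open>X\<close> converge, hence so does every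
  finite-rank truncation \<open>P\<close>. The truncation error is uniformly small on the bounded
  range of \<open>X\<close>, so three thirds of \<open>\<epsilon>\<close> show that the images are
  Cauchy.\<close>

lemma Hilbert_Schmidt_compact:
  fixes W :: "'a::{real_inner, banach} \<Rightarrow> 'a" and X :: "nat \<Rightarrow> 'a"
  assumes e: "complete_orthonormal_system e" and W: "bounded_linear W"
    and h: "summable (\<lambda>j. (norm (W (e j)))\<^sup>2)" and X: "bounded (range X)"
  shows "\<exists>r. strict_mono r \<and> convergent (W \<circ> X \<circ> r)"
proof -
  note oe = complete_orthonormal_system_seq[OF e]
  obtain B where B: "\<And>n. norm (X n) \<le> B" "B > 0" using X by (auto simp: bounded_pos)
  have "\<bar>X n \<bullet> e j\<bar> \<le> B" for n j
    using Cauchy_Schwarz_ineq2[of "X n" "e j"] B(1)[of n] orthonormal_seq_norm[OF oe, of j] by simp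
  then obtain r where r: "strict_mono r" "\<And>j. convergent (\<lambda>n. X (r n) \<bullet> e j)"
    using coordinatewise_convergent_subsequence[of "\<lambda>n j. X n \<bullet> e j" "\<lambda>_. B"] by blast
  have "Cauchy (W \<circ> X \<circ> r)"
  proof (rule metric_CauchyI)
    fix \<epsilon> :: real assume "\<epsilon> > 0"
    define tail where "tail N = (\<Sum>j. (norm (W (e (j + N))))\<^sup>2)" for N
    have tail0: "0 \<le> tail N" for N
      unfolding tail_def using summable_ignore_initial_segment[OF h] by (intro suminf_nonneg) auto
    have "(\<lambda>N. sqrt (tail N)) \<longlonglongrightarrow> sqrt 0"
      unfolding tail_def by (intro tendsto_real_sqrt suminf_exist_split2 h)
    then have "(\<lambda>N. B * sqrt (tail N)) \<longlonglongrightarrow> 0" by (auto intro: tendsto_mult_right_zero)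
    then have "\<forall>\<^sub>F N in sequentially. B * sqrt (tail N) < \<epsilon> / 3"
      using \<open>\<epsilon> > 0\<close> by (intro order_tendstoD(2)) auto
    then obtain N where N: "B * sqrt (tail N) < \<epsilon> / 3"
      by (auto simp: eventually_sequentially)
    define P where "P n = (\<Sum>j<N. (X (r n) \<bullet> e j) *\<^sub>R W (e j))" for n
    have "convergent P" unfolding P_def
    proof (rule convergent_sum)
      fix j
      obtain l where "(\<lambda>n. X (r n) \<bullet> e j) \<longlonglongrightarrow> l" using r(2) by (auto simp: convergent_def)
      then have "(\<lambda>n. (X (r n) \<bullet> e j) *\<^sub>R W (e j)) \<longlonglongrightarrow> l *\<^sub>R W (e j)" by (intro tendsto_intros)
      then show "convergent (\<lambda>n. (X (r n) \<bullet> e j) *\<^sub>R W (e j))" by (auto simp: convergent_def)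
    qed
    then have "Cauchy P" by (rule convergent_Cauchy)
    then obtain K where K: "\<And>m n. m \<ge> K \<Longrightarrow> n \<ge> K \<Longrightarrow> dist (P m) (P n) < \<epsilon> / 3"
      using \<open>\<epsilon> > 0\<close> unfolding Cauchy_def by (meson divide_pos_pos zero_less_numeral)
    have close: "dist (W (X (r n))) (P n) < \<epsilon> / 3" for n
    proof -
      have "dist (W (X (r n))) (P n) \<le> norm (X (r n)) * sqrt (tail N)"
        unfolding dist_norm P_def tail_def by (rule Hilbert_Schmidt_tail[OF e W h])
      also have "\<dots> \<le> B * sqrt (tail N)" using B tail0 by (intro mult_right_mono) auto
      finally show ?thesis using N by simp
    qed
    have "dist ((W \<circ> X \<circ> r) m) ((W \<circ> X \<circ> r) n) < \<epsilon>" if "m \<ge> K" "n \<ge> K" for m n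
      using dist_triangle_third[OF close[of m] K[OF that], of "W (X (r n))"] close[of n]
      by (simp add: o_def dist_commute)
    then show "\<exists>K. \<forall>m\<ge>K. \<forall>n\<ge>K. dist ((W \<circ> X \<circ> r) m) ((W \<circ> X \<circ> r) n) < \<epsilon>" by blast
  qed
  then show ?thesis using r(1) Cauchy_convergent by blast
qed

section \<open>The Gramian\<close>

locale stable_system =
  fixes e :: "nat \<Rightarrow> 'a::{real_inner, banach, second_countable_topology}"
    and T :: "real \<Rightarrow> 'a \<Rightarrow>\<^sub>L 'a"
    and M \<omega> :: real
  assumes onb: "complete_orthonormal_system e"
    and semigroup: "C0_semigroup T"
    and M_pos: "M > 0" and \<omega>_pos: "\<omega> > 0"
    and decay: "t \<ge> 0 \<Longrightarrow> norm (T t) \<le> M * exp (- \<omega> * t)"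
begin

lemmas onb_seq = complete_orthonormal_system_seq[OF onb]

section \<open>Integrable decay and continuity of the orbits\<close>

definition decay_sq :: "real \<Rightarrow> real" where
  "decay_sq t = (M * exp (- \<omega> * t))\<^sup>2"

text \<open>The constant of the operator bound on \<open>Gram p\<close>. The decay is squared
  because \<open>T t\<close> enters the integrand twice.\<close>

definition decay_int :: real where
  "decay_int = (LBINT t:{0..}. decay_sq t)"

lemma decay_sq_nonneg: "0 \<le> decay_sq t"
  by (simp add: decay_sq_def)

text \<open>The integral of the exponential is first available as a gauge integral. Nonnegativity
  makes it absolute, and Borel measurability carries it from the completed measure to
  \<open>lborel\<close>.\<close>

lemma set_integrable_decay: "set_integrable lborel {0..} decay_sq"
proof -
  have eq: "decay_sq = (\<lambda>t. M\<^sup>2 * exp (- (2 * \<omega>) * t))"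
    by (rule ext) (simp add: decay_sq_def power_mult_distrib power2_eq_square flip: exp_add)
  have "(\<lambda>t. exp (- (2 * \<omega>) * t)) integrable_on {0..}"
    by (rule has_integral_integrable[OF has_integral_exp_minus_to_infinity]) (use \<omega>_pos in simp)
  then have "(\<lambda>t. exp (- (2 * \<omega>) * t)) absolutely_integrable_on {0..}"
    by (intro nonnegative_absolutely_integrable_1) auto
  then have "set_integrable lborel {0..} (\<lambda>t. exp (- (2 * \<omega>) * t))"
    unfolding set_integrable_def by (subst (asm) integrable_completion) (auto intro!: borel_measurable_scaleR)
  then show ?thesis unfolding eq by (intro set_integrable_mult_right) auto
qed

lemma decay_int_nonneg: "0 \<le> decay_int"
  unfolding decay_int_def set_lebesgue_integral_def by (intro integral_nonneg_AE) (simp add: decay_sq_nonneg)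

lemma norm_T_le: "t \<ge> 0 \<Longrightarrow> norm (T t x) \<le> M * norm x"
proof -
  assume t: "t \<ge> 0"
  have "norm (T t) \<le> M * exp (- \<omega> * t)" by (rule decay[OF t])
  also have "\<dots> \<le> M * 1" using t M_pos \<omega>_pos by (intro mult_left_mono) auto
  finally have "norm (T t) * norm x \<le> M * norm x" by (intro mult_right_mono) auto
  then show ?thesis using norm_blinfun[of "T t" x] by linarith
qed

lemma norm_T_power2_le: "t \<ge> 0 \<Longrightarrow> (norm (T t x))\<^sup>2 \<le> decay_sq t * (norm x)\<^sup>2"
proof -
  assume t: "t \<ge> 0"
  have "norm (T t x) \<le> (M * exp (- \<omega> * t)) * norm x"
    using norm_blinfun[of "T t" x] mult_right_mono[OF decay[OF t] norm_ge_zero[of x]] by linarith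
  then show ?thesis
    unfolding decay_sq_def power_mult_distrib[symmetric] by (rule power_mono) simp
qed

text \<open>Only right continuity at 0 is given. The semigroup law writes an increment over
  \<open>h\<close> as \<open>T s (T h x - x)\<close>, and the uniform bound \<open>M\<close> makes
  \<open>\<delta>\<close> independent of \<open>s\<close>; taking the smaller of two times as
  \<open>s\<close> covers both sides.\<close>

lemma continuous_on_orbit: "continuous_on {0..} (\<lambda>t. T t x)"
  unfolding continuous_on_iff
proof (intro ballI allI impI)
  fix t \<epsilon> :: real assume t: "t \<in> {0..}" and \<epsilon>: "\<epsilon> > 0"
  have "((\<lambda>h. T h x) \<longlongrightarrow> x) (at_right 0)" using semigroup by (simp add: C0_semigroup_def)
  then have "\<forall>\<^sub>F h in at_right 0. dist (T h x) x < \<epsilon> / M" using \<epsilon> M_pos by (intro tendstoD) auto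
  then obtain \<delta> where \<delta>: "\<delta> > 0" "\<And>h. 0 < h \<Longrightarrow> h < \<delta> \<Longrightarrow> dist (T h x) x < \<epsilon> / M"
    unfolding eventually_at_right_field by auto
  have key: "dist (T (s + h) x) (T s x) < \<epsilon>" if "0 \<le> s" "0 \<le> h" "h < \<delta>" for s h
  proof (cases "h = 0")
    case False
    have "T (s + h) x - T s x = T s (T h x - x)"
      using semigroup that by (simp add: C0_semigroup_def blinfun.diff_right)
    then have "dist (T (s + h) x) (T s x) \<le> M * norm (T h x - x)"
      using norm_T_le[OF that(1)] by (simp add: dist_norm)
    also have "\<dots> < \<epsilon>" using \<delta>(2)[of h] that False M_pos by (simp add: dist_norm field_simps)
    finally show ?thesis .
  qed (use \<epsilon> in simp)
  have "dist (T s x) (T t x) < \<epsilon>" if s: "s \<in> {0..}" "dist s t < \<delta>" for s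
  proof (cases "s \<le> t")
    case True
    then show ?thesis using key[of s "t - s"] s by (simp add: dist_real_def dist_commute)
  next
    case False
    then show ?thesis using key[of t "s - t"] s t by (simp add: dist_real_def)
  qed
  then show "\<exists>\<delta>>0. \<forall>s\<in>{0..}. dist s t < \<delta> \<longrightarrow> dist (T s x) (T t x) < \<epsilon>"
    using \<delta>(1) by blast
qed

text \<open>The vector obtained by applying the adjoints of \<open>T t\<close> and \<open>B\<close>,
  then \<open>B\<close> and \<open>T t\<close>, to \<open>x\<close>, expanded along
  \<open>e\<close>. The two square roots have merged into \<open>p i\<close>, so weights of either
  sign make sense.\<close>

definition integrand :: "(nat \<Rightarrow> real) \<Rightarrow> 'a \<Rightarrow> real \<Rightarrow> 'a" where
  "integrand p x t = (\<Sum>i. (p i * (x \<bullet> T t (e i))) *\<^sub>R T t (e i))"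

text \<open>
  The Gramian as a function of the weights. Unlike \<^const>\<open>gramian\<close> it is visibly linear in \<open>p\<close>, and
  is of use also for weights without a sign, such as the difference of two points of the simplex.
\<close>

definition Gram :: "(nat \<Rightarrow> real) \<Rightarrow> 'a \<Rightarrow> 'a" where
  "Gram p x = (LBINT t:{0..}. integrand p x t)"

lemma norm_integrand_term_le:
  assumes "t \<ge> 0"
  shows "norm ((q * (x \<bullet> T t (e i))) *\<^sub>R T t (e i)) \<le> \<bar>q\<bar> * (decay_sq t * norm x)"
proof -
  have "norm ((q * (x \<bullet> T t (e i))) *\<^sub>R T t (e i)) = \<bar>q\<bar> * (\<bar>x \<bullet> T t (e i)\<bar> * norm (T t (e i)))"
    by (simp add: abs_mult)
  also have "\<dots> \<le> \<bar>q\<bar> * ((norm x * norm (T t (e i))) * norm (T t (e i)))"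
    by (intro mult_left_mono mult_right_mono Cauchy_Schwarz_ineq2) auto
  also have "\<dots> = \<bar>q\<bar> * ((norm (T t (e i)))\<^sup>2 * norm x)" by (simp add: power2_eq_square)
  also have "\<dots> \<le> \<bar>q\<bar> * (decay_sq t * norm x)"
    using norm_T_power2_le[OF assms, of "e i"] orthonormal_seq_norm[OF onb_seq, of i]
    by (intro mult_left_mono mult_right_mono) auto
  finally show ?thesis .
qed

section \<open>The Gramian for absolutely summable weights\<close>

context
  fixes p :: "nat \<Rightarrow> real"
  assumes p: "summable (\<lambda>i. \<bar>p i\<bar>)"
begin

lemma summable_norm_integrand:
  assumes "t \<ge> 0"
  shows "summable (\<lambda>i. norm ((p i * (x \<bullet> T t (e i))) *\<^sub>R T t (e i)))"
proof (rule summable_comparison_test')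
  show "summable (\<lambda>i. \<bar>p i\<bar> * (decay_sq t * norm x))" by (intro summable_mult2 p)
qed (use norm_integrand_term_le[OF assms] in simp)

lemma integrand_sums:
  assumes "t \<ge> 0"
  shows "(\<lambda>i. (p i * (x \<bullet> T t (e i))) *\<^sub>R T t (e i)) sums integrand p x t"
  unfolding integrand_def
  by (rule summable_sums[OF summable_norm_cancel[OF summable_norm_integrand[OF assms]]])

lemma integrand_inner_sums:
  assumes "t \<ge> 0"
  shows "(\<lambda>i. p i * ((x \<bullet> T t (e i)) * (y \<bullet> T t (e i)))) sums (integrand p x t \<bullet> y)"
proof -
  have "((p i * (x \<bullet> T t (e i))) *\<^sub>R T t (e i)) \<bullet> y = p i * ((x \<bullet> T t (e i)) * (y \<bullet> T t (e i)))" for i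
    by (simp add: inner_commute[of y])
  then show ?thesis
    using bounded_linear.sums[OF bounded_linear_inner_left integrand_sums[OF assms, of x], of y] by (simp only:)
qed

lemma norm_integrand_le:
  assumes "t \<ge> 0"
  shows "norm (integrand p x t) \<le> (\<Sum>i. \<bar>p i\<bar>) * norm x * decay_sq t"
proof -
  have "norm (integrand p x t) \<le> (\<Sum>i. norm ((p i * (x \<bullet> T t (e i))) *\<^sub>R T t (e i)))"
    unfolding integrand_def by (rule summable_norm[OF summable_norm_integrand[OF assms]])
  also have "\<dots> \<le> (\<Sum>i. \<bar>p i\<bar> * (decay_sq t * norm x))"
    by (intro suminf_le norm_integrand_term_le assms summable_norm_integrand summable_mult2 p)
  also have "\<dots> = (\<Sum>i. \<bar>p i\<bar>) * norm x * decay_sq t"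
    by (subst suminf_mult2[OF p, symmetric]) (simp add: mult_ac)
  finally show ?thesis .
qed

lemma set_borel_measurable_integrand: "set_borel_measurable lborel {0..} (integrand p x)"
proof -
  \<comment> \<open>Orbits are known to be continuous for \<open>t \<ge> 0\<close> only, so the
    indicator is put inside the series and measurability is shown term by term.\<close>
  have "(\<lambda>t. indicator {0..} t *\<^sub>R ((p i * (x \<bullet> T t (e i))) *\<^sub>R T t (e i))) \<in> borel_measurable borel" for i
    by (intro borel_measurable_continuous_on_indicator continuous_intros continuous_on_orbit) auto
  then have "(\<lambda>t. \<Sum>i. indicator {0..} t *\<^sub>R ((p i * (x \<bullet> T t (e i))) *\<^sub>R T t (e i))) \<in> borel_measurable borel"
    by (rule borel_measurable_suminf)
  also have "(\<lambda>t. \<Sum>i. indicator {0..} t *\<^sub>R ((p i * (x \<bullet> T t (e i))) *\<^sub>R T t (e i)))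
      = (\<lambda>t. indicator {0..} t *\<^sub>R integrand p x t)"
    by (rule ext) (simp add: integrand_def indicator_def)
  finally show ?thesis by (simp add: set_borel_measurable_def)
qed

lemma set_integrable_integrand: "set_integrable lborel {0..} (integrand p x)"
proof (rule set_integrable_bound)
  show "set_integrable lborel {0..} (\<lambda>t. (\<Sum>i. \<bar>p i\<bar>) * norm x * decay_sq t)"
    using set_integrable_decay by (intro set_integrable_mult_right) auto
  have "0 \<le> (\<Sum>i. \<bar>p i\<bar>)" using p by (intro suminf_nonneg) auto
  then show "AE t in lborel. t \<in> {0..} \<longrightarrow> norm (integrand p x t) \<le> norm ((\<Sum>i. \<bar>p i\<bar>) * norm x * decay_sq t)"
    using norm_integrand_le decay_sq_nonneg by (intro AE_I2 impI) (simp add: abs_mult)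
qed (rule set_borel_measurable_integrand)

lemma norm_Gram_le: "norm (Gram p x) \<le> decay_int * (\<Sum>i. \<bar>p i\<bar>) * norm x"
proof -
  have "norm (Gram p x) \<le> (LBINT t:{0..}. norm (integrand p x t))"
    unfolding Gram_def by (rule set_integral_norm_bound[OF set_integrable_integrand])
  also have "\<dots> \<le> (LBINT t:{0..}. (\<Sum>i. \<bar>p i\<bar>) * norm x * decay_sq t)"
    using norm_integrand_le set_integrable_decay
    by (intro set_integral_mono set_integrable_norm set_integrable_integrand set_integrable_mult_right) auto
  also have "\<dots> = decay_int * (\<Sum>i. \<bar>p i\<bar>) * norm x" by (simp add: decay_int_def)
  finally show ?thesis .
qed

lemma Gram_inner: "Gram p x \<bullet> y = (LBINT t:{0..}. integrand p x t \<bullet> y)"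
  using integral_inner_left[of y lborel "\<lambda>t. indicator {0..} t *\<^sub>R integrand p x t"]
    set_integrable_integrand[of x]
  by (simp add: Gram_def set_lebesgue_integral_def set_integrable_def)

lemma set_integrable_integrand_inner: "set_integrable lborel {0..} (\<lambda>t. integrand p x t \<bullet> y)"
  using integrable_inner_left[of y lborel "\<lambda>t. indicator {0..} t *\<^sub>R integrand p x t"]
    set_integrable_integrand[of x]
  by (simp add: set_integrable_def)

lemma Gram_symmetric: "Gram p x \<bullet> y = x \<bullet> Gram p y"
proof -
  have "integrand p x t \<bullet> y = integrand p y t \<bullet> x" if "t \<ge> 0" for t
    using integrand_inner_sums[OF that, of x y] integrand_inner_sums[OF that, of y x]
    unfolding mult.commute[of "y \<bullet> _"] by (rule sums_unique2)
  then have "Gram p x \<bullet> y = Gram p y \<bullet> x"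
    unfolding Gram_inner by (intro set_lebesgue_integral_cong) auto
  then show ?thesis by (simp add: inner_commute)
qed

lemma bounded_linear_Gram: "bounded_linear (Gram p)"
proof (rule bounded_linear_intro)
  fix x y r
  have "integrand p (x + y) t = integrand p x t + integrand p y t" if "t \<ge> 0" for t
    using integrand_sums[OF that, of "x + y"]
      sums_add[OF integrand_sums[OF that, of x] integrand_sums[OF that, of y]]
    unfolding inner_add_left distrib_left scaleR_add_left by (rule sums_unique2)
  then have "Gram p (x + y) = (LBINT t:{0..}. integrand p x t + integrand p y t)"
    unfolding Gram_def by (intro set_lebesgue_integral_cong) auto
  then show "Gram p (x + y) = Gram p x + Gram p y"
    by (simp add: Gram_def set_integral_add(2) set_integrable_integrand)
  have "integrand p (r *\<^sub>R x) t = r *\<^sub>R integrand p x t" if "t \<ge> 0" for t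
  proof (rule sums_unique2[OF integrand_sums[OF that]])
    have "r *\<^sub>R (p i * (x \<bullet> T t (e i))) *\<^sub>R T t (e i) = (p i * (r *\<^sub>R x \<bullet> T t (e i))) *\<^sub>R T t (e i)" for i
      by simp
    then show "(\<lambda>i. (p i * (r *\<^sub>R x \<bullet> T t (e i))) *\<^sub>R T t (e i)) sums (r *\<^sub>R integrand p x t)"
      using sums_scaleR_right[OF integrand_sums[OF that, of x], of r] by presburger
  qed
  then have "Gram p (r *\<^sub>R x) = (LBINT t:{0..}. r *\<^sub>R integrand p x t)"
    unfolding Gram_def by (intro set_lebesgue_integral_cong) auto
  then show "Gram p (r *\<^sub>R x) = r *\<^sub>R Gram p x" by (simp add: Gram_def)
  show "norm (Gram p x) \<le> norm x * (decay_int * (\<Sum>i. \<bar>p i\<bar>))"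
    using norm_Gram_le[of x] by (simp add: mult.commute)
qed

end

lemma Gram_diff:
  assumes p: "summable (\<lambda>i. \<bar>p i\<bar>)" and q: "summable (\<lambda>i. \<bar>q i\<bar>)"
  shows "Gram (\<lambda>i. p i - q i) x = Gram p x - Gram q x"
proof -
  have pq: "summable (\<lambda>i. \<bar>p i - q i\<bar>)"
    by (rule summable_comparison_test'[OF summable_add[OF p q]]) (simp add: abs_triangle_ineq4)
  have "integrand (\<lambda>i. p i - q i) x t = integrand p x t - integrand q x t" if "t \<ge> 0" for t
    using integrand_sums[OF pq that, of x]
      sums_diff[OF integrand_sums[OF p that, of x] integrand_sums[OF q that, of x]]
    unfolding left_diff_distrib scaleR_diff_left by (rule sums_unique2)
  then have "Gram (\<lambda>i. p i - q i) x = (LBINT t:{0..}. integrand p x t - integrand q x t)"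
    unfolding Gram_def by (intro set_lebesgue_integral_cong) auto
  then show ?thesis
    by (simp add: Gram_def set_integral_diff(2) set_integrable_integrand p q)
qed

text \<open>Linearity in the weights turns the difference into the form of one operator with the
  signed weights \<open>p i - q i\<close>, to which the norm bound applies. This supplies the
  hypothesis of \<open>Weyl_perturbation\<close>.\<close>

lemma form_Gram_diff_le:
  assumes p: "summable (\<lambda>i. \<bar>p i\<bar>)" and q: "summable (\<lambda>i. \<bar>q i\<bar>)"
  shows "\<bar>Gram p x \<bullet> x - Gram q x \<bullet> x\<bar> \<le> decay_int * (\<Sum>i. \<bar>p i - q i\<bar>) * (norm x)\<^sup>2"
proof -
  have pq: "summable (\<lambda>i. \<bar>p i - q i\<bar>)"
    by (rule summable_comparison_test'[OF summable_add[OF p q]]) (simp add: abs_triangle_ineq4)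
  have "\<bar>Gram p x \<bullet> x - Gram q x \<bullet> x\<bar> = \<bar>Gram (\<lambda>i. p i - q i) x \<bullet> x\<bar>"
    by (simp add: Gram_diff[OF p q] inner_diff_left)
  also have "\<dots> \<le> norm (Gram (\<lambda>i. p i - q i) x) * norm x" by (rule Cauchy_Schwarz_ineq2)
  also have "\<dots> \<le> (decay_int * (\<Sum>i. \<bar>p i - q i\<bar>) * norm x) * norm x"
    by (intro mult_right_mono norm_Gram_le pq) auto
  finally show ?thesis by (simp add: power2_eq_square mult.assoc)
qed

section \<open>Nonnegative weights: positivity, finite trace and compactness\<close>

context
  fixes p :: "nat \<Rightarrow> real"
  assumes p: "summable p" and p0: "\<And>i. 0 \<le> p i"
begin

lemma summable_abs_weights: "summable (\<lambda>i. \<bar>p i\<bar>)"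
  using p p0 by simp

lemma psd_operator_Gram: "psd_operator (Gram p)"
proof (rule psd_operator.intro)
  show "bounded_linear (Gram p)" by (rule bounded_linear_Gram[OF summable_abs_weights])
  show "Gram p x \<bullet> y = x \<bullet> Gram p y" for x y by (rule Gram_symmetric[OF summable_abs_weights])
  have "0 \<le> integrand p x t \<bullet> x" if "t \<ge> 0" for t x
    using p0 sums_le[OF _ sums_zero integrand_inner_sums[OF summable_abs_weights that, of x x]] by simp
  then show "0 \<le> Gram p x \<bullet> x" for x
    unfolding Gram_inner[OF summable_abs_weights] set_lebesgue_integral_def
    by (intro integral_nonneg_AE AE_I2) (simp add: indicator_def)
qed

text \<open>Under the integral, the sum over \<open>j\<close> moves inside the series over
  \<open>i\<close>. Bessel then bounds the sum of the
  \<open>(T t (e i) \<bullet> e j)\<^sup>2\<close> by \<open>(norm (T t (e i)))\<^sup>2\<close>,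
  hence by \<open>decay_sq t\<close>.\<close>

lemma trace_Gram_le: "(\<Sum>j<n. Gram p (e j) \<bullet> e j) \<le> decay_int * (\<Sum>i. p i)"
proof -
  have le: "(\<Sum>j<n. integrand p (e j) t \<bullet> e j) \<le> (\<Sum>i. p i) * decay_sq t" if t: "t \<ge> 0" for t
  proof (rule sums_le)
    show "(\<lambda>i. \<Sum>j<n. p i * ((e j \<bullet> T t (e i)) * (e j \<bullet> T t (e i)))) sums (\<Sum>j<n. integrand p (e j) t \<bullet> e j)"
      by (intro sums_sum integrand_inner_sums[OF summable_abs_weights t])
    show "(\<lambda>i. p i * decay_sq t) sums ((\<Sum>i. p i) * decay_sq t)"
      by (intro sums_mult2 summable_sums p)
    fix i
    have "(\<Sum>j<n. p i * ((e j \<bullet> T t (e i)) * (e j \<bullet> T t (e i)))) = p i * (\<Sum>j<n. (T t (e i) \<bullet> e j)\<^sup>2)"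
      by (simp add: sum_distrib_left power2_eq_square inner_commute)
    also have "\<dots> \<le> p i * (norm (T t (e i)))\<^sup>2"
      by (intro mult_left_mono Bessel_inequality[OF onb_seq] p0) simp
    also have "\<dots> \<le> p i * decay_sq t"
      using norm_T_power2_le[OF t, of "e i"] orthonormal_seq_norm[OF onb_seq, of i]
      by (intro mult_left_mono p0) simp
    finally show "(\<Sum>j<n. p i * ((e j \<bullet> T t (e i)) * (e j \<bullet> T t (e i)))) \<le> p i * decay_sq t" .
  qed
  have int: "set_integrable lborel {0..} (\<lambda>t. \<Sum>j<n. integrand p (e j) t \<bullet> e j)"
    using set_integrable_integrand_inner[OF summable_abs_weights]
    unfolding set_integrable_def scaleR_sum_right by (intro Bochner_Integration.integrable_sum) auto
  have "(\<Sum>j<n. Gram p (e j) \<bullet> e j) = (LBINT t:{0..}. \<Sum>j<n. integrand p (e j) t \<bullet> e j)"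
    using set_integrable_integrand_inner[OF summable_abs_weights]
    unfolding Gram_inner[OF summable_abs_weights] set_lebesgue_integral_def set_integrable_def scaleR_sum_right
    by (intro Bochner_Integration.integral_sum[symmetric]) auto
  also have "\<dots> \<le> (LBINT t:{0..}. (\<Sum>i. p i) * decay_sq t)"
    using le set_integrable_decay by (intro set_integral_mono int set_integrable_mult_right) auto
  also have "\<dots> = decay_int * (\<Sum>i. p i)" by (simp add: decay_int_def)
  finally show ?thesis .
qed

text \<open>The constant \<open>C\<close> bounds both the form on unit vectors and the partial
  traces. By \<open>norm_power2_le\<close> the squared norm of each image of \<open>e j\<close> is
  at most \<open>C\<close> times a diagonal entry, so the Hilbert-Schmidt sum is at most
  \<open>C * C\<close>.\<close>

lemma compact_psd_operator_Gram: "compact_psd_operator (Gram p)"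
proof -
  interpret psd_operator "Gram p" by (rule psd_operator_Gram)
  define C where "C = decay_int * (\<Sum>i. p i)"
  have C: "0 \<le> C" unfolding C_def using decay_int_nonneg p p0 by (simp add: suminf_nonneg)
  have form_le: "Gram p x \<bullet> x \<le> C * (norm x)\<^sup>2" for x
  proof -
    have "Gram p x \<bullet> x \<le> norm (Gram p x) * norm x" by (rule norm_cauchy_schwarz)
    also have "\<dots> \<le> (C * norm x) * norm x"
      using norm_Gram_le[OF summable_abs_weights, of x] p0 by (intro mult_right_mono) (simp_all add: C_def)
    finally show ?thesis by (simp add: power2_eq_square mult.assoc)
  qed
  have "(\<Sum>j<n. (norm (Gram p (e j)))\<^sup>2) \<le> C * C" for n
  proof -
    have "(\<Sum>j<n. (norm (Gram p (e j)))\<^sup>2) \<le> (\<Sum>j<n. C * (Gram p (e j) \<bullet> e j))"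
      by (intro sum_mono norm_power2_le form_le)
    also have "\<dots> = C * (\<Sum>j<n. Gram p (e j) \<bullet> e j)" by (simp add: sum_distrib_left)
    also have "\<dots> \<le> C * C" unfolding C_def by (intro mult_left_mono trace_Gram_le C[unfolded C_def])
    finally show ?thesis .
  qed
  then have "summable (\<lambda>j. (norm (Gram p (e j)))\<^sup>2)" by (intro summableI_nonneg_bounded) auto
  then show ?thesis
    using Hilbert_Schmidt_compact[OF onb bounded_linear] by unfold_locales blast
qed

lemma gramian_eq_Gram: "gramian T e p = Gram p"
proof
  fix x
  define B where "B = input_op e p"
  \<comment> \<open>Nonnegative summable weights are bounded by their sum, which is the bound that
    \<open>input_op_apply\<close> asks for.\<close>
  have "p i \<le> (\<Sum>i. p i)" for i
    using sum_le_suminf[OF p, of "{i}"] p0 by simp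
  then have B: "B (e i) = sqrt (p i) *\<^sub>R e i" for i
    unfolding B_def by (intro input_op_apply[OF onb]) (use p0 in auto)
  have "T t (B (adjoint (blinfun_apply B) (adjoint (blinfun_apply (T t)) x))) = integrand p x t" for t
  proof -
    define z where "z = adjoint (blinfun_apply B) (adjoint (blinfun_apply (T t)) x)"
    \<comment> \<open>Moving both adjoints onto \<open>e i\<close> gives the coefficients of
      \<open>z\<close>. Applying \<open>B\<close> supplies the second \<open>sqrt (p i)\<close>, and
      \<open>T t\<close> then acts term by term.\<close>
    have "z \<bullet> e i = sqrt (p i) * (x \<bullet> T t (e i))" for i
    proof -
      have "e i \<bullet> z = B (e i) \<bullet> adjoint (blinfun_apply (T t)) x"
        unfolding z_def by (rule adjoint_bounded_linear[OF onb blinfun.bounded_linear_right, symmetric])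
      also have "\<dots> = sqrt (p i) * (T t (e i) \<bullet> x)"
        by (simp add: B adjoint_bounded_linear[OF onb blinfun.bounded_linear_right])
      finally show ?thesis by (simp add: inner_commute)
    qed
    then have "(z \<bullet> e i) *\<^sub>R B (e i) = (p i * (x \<bullet> T t (e i))) *\<^sub>R e i" for i
      using real_sqrt_mult_self[of "p i"] p0[of i] by (simp add: B)
    then have "(\<lambda>i. (p i * (x \<bullet> T t (e i))) *\<^sub>R e i) sums B z"
      using bounded_linear_expansion[OF onb blinfun.bounded_linear_right[of B], of z] by (simp only:)
    from bounded_linear.sums[OF blinfun.bounded_linear_right this, of "T t"]
    have "(\<lambda>i. (p i * (x \<bullet> T t (e i))) *\<^sub>R T t (e i)) sums T t (B z)"
      by (simp add: blinfun.scaleR_right)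
    then show ?thesis unfolding integrand_def z_def by (simp add: sums_iff)
  qed
  then show "gramian T e p x = Gram p x"
    by (simp add: gramian_def Gram_def B_def Let_def)
qed

end

end

section \<open>Existence of minimisers\<close>

text \<open>By the Weierstrass M-test the series is a uniform limit of finite sums, each depending
  on finitely many coordinates and so continuous in the product topology.\<close>

lemma continuous_on_suminf_coordinates:
  fixes f :: "nat \<Rightarrow> real \<Rightarrow> real"
  assumes cont: "\<And>i. continuous_on UNIV (f i)" and bound: "\<And>p i. p \<in> S \<Longrightarrow> \<bar>f i (p i)\<bar> \<le> b i"
    and b: "summable b"
  shows "continuous_on S (\<lambda>p. \<Sum>i. f i (p i))"
proof (rule uniform_limit_theorem)
  show "uniform_limit S (\<lambda>n p. \<Sum>i<n. f i (p i)) (\<lambda>p. \<Sum>i. f i (p i)) sequentially"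
    using bound b by (intro Weierstrass_m_test) auto
  have "continuous_on S (\<lambda>p. f i (p i))" for i
    by (rule continuous_on_compose2[OF cont]) (auto intro: continuous_on_subset[OF continuous_on_product_coordinates])
  then show "\<forall>\<^sub>F n in sequentially. continuous_on S (\<lambda>p. \<Sum>i<n. f i (p i))"
    by (intro always_eventually allI continuous_on_sum)
qed simp

text \<open>The feasible set without the strict condition on the \<open>n\<close>-th eigenvalue,
  with which it need not be closed.\<close>

definition dominated_simplex :: "(nat \<Rightarrow> real) \<Rightarrow> (nat \<Rightarrow> real) set" where
  "dominated_simplex a = {p \<in> Simplex. \<forall>i. p i \<le> a i}"

lemma dominated_simplexD:
  assumes "p \<in> dominated_simplex a"
  shows "0 \<le> p i" "p i \<le> a i" "summable p" "summable (\<lambda>i. \<bar>p i\<bar>)"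
  using assms by (auto simp: dominated_simplex_def Simplex_def dest: sums_summable)

text \<open>The box with sides \<open>{0..a i}\<close> is compact by Tychonoff. Domination by the
  summable \<open>a\<close> keeps mass from escaping to infinity: the total mass is continuous on
  the box, so having mass 1 is a closed condition.\<close>

lemma compact_dominated_simplex:
  assumes a: "summable a"
  shows "compact (dominated_simplex a)"
proof -
  define S where "S = PiE UNIV (\<lambda>i. {0..a i})"
  have S: "p \<in> S \<longleftrightarrow> (\<forall>i. 0 \<le> p i \<and> p i \<le> a i)" for p by (auto simp: S_def PiE_UNIV_domain)
  have "compactin (product_topology (\<lambda>_. euclidean) UNIV) S"
    unfolding S_def compactin_PiE by simp
  then have "compact S" by (simp add: euclidean_product_topology)
  moreover have "continuous_on S (\<lambda>p. \<Sum>i. p i)"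
    by (rule continuous_on_suminf_coordinates[where f = "\<lambda>_ x. x", OF _ _ a]) (auto simp: S)
  ultimately have "compact {p \<in> S. (\<Sum>i. p i) = 1}"
    using continuous_closedin_preimage[of S "\<lambda>p. \<Sum>i. p i" "{1}"] closedin_compact
    by (auto simp: vimage_def Int_def)
  moreover have "p sums 1 \<longleftrightarrow> (\<Sum>i. p i) = 1" if "p \<in> S" for p
  proof -
    have "summable p" by (rule summable_comparison_test'[OF a]) (use that S in auto)
    then show ?thesis by (auto simp: sums_iff)
  qed
  then have "dominated_simplex a = {p \<in> S. (\<Sum>i. p i) = 1}"
    by (auto simp: dominated_simplex_def Simplex_def S)
  ultimately show ?thesis by simp
qed

lemma feasible_iff: "p \<in> feasible T e n a \<longleftrightarrow> p \<in> dominated_simplex a \<and> 0 < mu (gramian T e p) n"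
  by (auto simp: feasible_def X_set_def dominated_simplex_def Simplex_def)

section \<open>Eigenvalues of the Gramian as functions of the weights\<close>

context stable_system
begin

lemma mu_gramian_nonneg: "p \<in> dominated_simplex a \<Longrightarrow> 0 \<le> mu (gramian T e p) k"
  using mu_nonneg[OF onb_seq compact_psd_operator_Gram] gramian_eq_Gram dominated_simplexD by metis

lemma mu_gramian_antimono:
  "p \<in> dominated_simplex a \<Longrightarrow> j \<le> k \<Longrightarrow> mu (gramian T e p) k \<le> mu (gramian T e p) j"
  using mu_antimono[OF onb_seq compact_psd_operator_Gram] gramian_eq_Gram dominated_simplexD by metis

text \<open>Weyl's inequality squeezes the change of the eigenvalue from \<open>q\<close> to
  \<open>p\<close> below \<open>d p\<close>. This \<open>d\<close> is continuous with
  \<open>d q = 0\<close>, its terms being dominated by \<open>a i\<close> since \<open>p i\<close>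
  and \<open>q i\<close> both lie in \<open>{0..a i}\<close>.\<close>

lemma continuous_on_mu_gramian:
  assumes a: "summable a"
  shows "continuous_on (dominated_simplex a) (\<lambda>p. mu (gramian T e p) k)"
  unfolding continuous_on_def
proof
  fix q assume q: "q \<in> dominated_simplex a"
  note qD = dominated_simplexD[OF q]
  define d where "d p = decay_int * (\<Sum>i. \<bar>p i - q i\<bar>)" for p
  have "continuous_on (dominated_simplex a) d"
    unfolding d_def
  proof (intro continuous_intros continuous_on_suminf_coordinates[where f = "\<lambda>i x. \<bar>x - q i\<bar>"])
    show "\<bar>\<bar>p i - q i\<bar>\<bar> \<le> a i" if "p \<in> dominated_simplex a" for p i
      using dominated_simplexD(1,2)[OF that, of i] qD(1,2)[of i] by simp
  qed (rule a)
  moreover have "d q = 0" by (simp add: d_def)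
  ultimately have d: "(d \<longlongrightarrow> 0) (at q within dominated_simplex a)"
    using q by (metis continuous_on_def)
  have le: "\<bar>mu (gramian T e p) k - mu (gramian T e q) k\<bar> \<le> d p" if p: "p \<in> dominated_simplex a" for p
  proof -
    note pD = dominated_simplexD[OF p]
    show ?thesis
      unfolding gramian_eq_Gram[OF pD(3,1)] gramian_eq_Gram[OF qD(3,1)] d_def
      by (intro Weyl_perturbation[OF onb_seq] compact_psd_operator_Gram form_Gram_diff_le pD qD)
  qed
  have "((\<lambda>p. mu (gramian T e p) k - mu (gramian T e q) k) \<longlongrightarrow> 0) (at q within dominated_simplex a)"
    by (rule Lim_null_comparison[OF _ d]) (use le in \<open>auto simp: eventually_at_filter\<close>)
  then show "((\<lambda>p. mu (gramian T e p) k) \<longlongrightarrow> mu (gramian T e q) k) (at q within dominated_simplex a)"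
    by (simp add: LIM_zero_iff)
qed

section \<open>The two minimisation problems\<close>

context
  fixes a :: "nat \<Rightarrow> real" and n :: nat
  assumes a: "summable a" and n: "n \<ge> 1" and nonempty: "feasible T e n a \<noteq> {}"
begin

lemma feasible_mu_pos: "p \<in> feasible T e n a \<Longrightarrow> k \<le> n \<Longrightarrow> 0 < mu (gramian T e p) k"
  using mu_gramian_antimono[of p a k n] by (auto simp: feasible_iff)

text \<open>As \<open>- ln\<close> is decreasing on positive reals, it suffices to maximise the
  product \<open>h\<close> over \<open>dominated_simplex a\<close>. The maximiser is feasible: a
  vanishing \<open>n\<close>-th factor would make \<open>h p = 0\<close>, below the positive value
  at \<open>p0\<close>.\<close>

lemma f_obj_has_minimizer: "\<exists>p. optimal_solution (f_obj T e n) (feasible T e n a) p"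
proof -
  define h where "h p = (\<Prod>k=1..n. mu (gramian T e p) k)" for p
  have pos: "0 < h p" if "p \<in> feasible T e n a" for p
    using feasible_mu_pos[OF that] by (auto simp: h_def intro!: prod_pos)
  obtain p0 where p0: "p0 \<in> feasible T e n a" using nonempty by blast
  have "continuous_on (dominated_simplex a) h"
    unfolding h_def by (intro continuous_intros continuous_on_mu_gramian a)
  then obtain p where p: "p \<in> dominated_simplex a" "\<And>q. q \<in> dominated_simplex a \<Longrightarrow> h q \<le> h p"
    using continuous_attains_sup[OF compact_dominated_simplex[OF a]] p0 by (metis empty_iff feasible_iff)
  have "0 < h p" using pos[OF p0] p(2)[of p0] p0 by (simp add: feasible_iff)
  have "mu (gramian T e p) n \<noteq> 0"
  proof
    assume "mu (gramian T e p) n = 0"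
    then have "h p = 0" unfolding h_def using n by (intro prod_zero bexI[of _ n]) auto
    then show False using \<open>0 < h p\<close> by simp
  qed
  then have feas: "p \<in> feasible T e n a"
    using mu_gramian_nonneg[OF p(1), of n] p(1) by (simp add: feasible_iff)
  have "f_obj T e n p \<le> f_obj T e n q" if "q \<in> feasible T e n a" for q
    using p(2)[of q] pos[OF that] that by (simp add: f_obj_def h_def feasible_iff)
  then show ?thesis using feas by (auto simp: optimal_solution_def)
qed

text \<open>
  Weights with \<open>\<mu>\<^sub>n < \<delta> = 1 / g(p\<^sub>0)\<close> cannot beat the feasible point \<open>p\<^sub>0\<close>, so the search may be
  restricted to a compact set on which the objective is continuous.
\<close>

lemma g_obj_has_minimizer: "\<exists>p. optimal_solution (g_obj T e n) (feasible T e n a) p"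
proof -
  obtain p0 where p0: "p0 \<in> feasible T e n a" using nonempty by blast
  have ge: "1 / mu (gramian T e p) n \<le> g_obj T e n p" if "p \<in> feasible T e n a" for p
    unfolding g_obj_def using feasible_mu_pos[OF that] n
    by (intro member_le_sum[where f = "\<lambda>k. 1 / mu (gramian T e p) k"]) (auto intro: less_imp_le)
  have mu0: "0 < mu (gramian T e p0) n" by (rule feasible_mu_pos[OF p0]) simp
  then have g0: "0 < g_obj T e n p0" using ge[OF p0] by (meson divide_pos_pos less_le_trans zero_less_one)
  define \<delta> where "\<delta> = 1 / g_obj T e n p0"
  have \<delta>: "\<delta> > 0" using g0 by (simp add: \<delta>_def)
  define L where "L = {p \<in> dominated_simplex a. \<delta> \<le> mu (gramian T e p) n}"
  have L_feas: "p \<in> feasible T e n a" if "p \<in> L" for p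
    using that \<delta> by (auto simp: L_def feasible_iff)
  \<comment> \<open>One term of a positive sum is at most the sum:
    \<open>1 / mu (gramian T e p0) n\<close> does not exceed \<open>g_obj T e n p0\<close>, which is
    \<open>1 / \<delta>\<close>.\<close>
  have "p0 \<in> L"
    using p0 ge[OF p0] mu0 g0 by (simp add: L_def feasible_iff \<delta>_def field_simps)
  have "L = dominated_simplex a \<inter> (\<lambda>p. mu (gramian T e p) n) -` {\<delta>..}" by (auto simp: L_def)
  then have "compact L"
    using continuous_closedin_preimage[OF continuous_on_mu_gramian[OF a], of "{\<delta>..}" n]
      closedin_compact[OF compact_dominated_simplex[OF a]] by simp
  moreover have "continuous_on L (g_obj T e n)"
    unfolding g_obj_def
  proof (intro continuous_intros ballI)
    show "continuous_on L (\<lambda>p. mu (gramian T e p) k)" for k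
      by (rule continuous_on_subset[OF continuous_on_mu_gramian[OF a]]) (auto simp: L_def)
    show "mu (gramian T e p) k \<noteq> 0" if "k \<in> {1..n}" "p \<in> L" for k p
      using feasible_mu_pos[OF L_feas[OF that(2)], of k] that(1) by simp
  qed
  ultimately obtain p where p: "p \<in> L" "\<And>q. q \<in> L \<Longrightarrow> g_obj T e n p \<le> g_obj T e n q"
    using continuous_attains_inf[of L "g_obj T e n"] \<open>p0 \<in> L\<close> by auto
  have "g_obj T e n p \<le> g_obj T e n q" if q: "q \<in> feasible T e n a" for q
  proof (cases "q \<in> L")
    \<comment> \<open>Outside \<open>L\<close> the \<open>n\<close>-th term alone exceeds
      \<open>1 / \<delta>\<close>, the value at \<open>p0\<close>, which is at least the minimum
      over \<open>L\<close>.\<close>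
    case False
    then have "mu (gramian T e q) n < \<delta>" using q by (simp add: L_def feasible_iff)
    moreover have "0 < mu (gramian T e q) n" by (rule feasible_mu_pos[OF q]) simp
    ultimately have "g_obj T e n p0 < 1 / mu (gramian T e q) n"
      using g0 by (simp add: \<delta>_def field_simps)
    then show ?thesis using ge[OF q] p(2)[OF \<open>p0 \<in> L\<close>] by simp
  qed (rule p(2))
  then show ?thesis using L_feas[OF p(1)] by (auto simp: optimal_solution_def)
qed

end

end

theorem theorem3p9:
  fixes e :: "nat \<Rightarrow> 'a::{real_inner, banach, second_countable_topology}"
    and D :: "'a set" and A :: "'a \<Rightarrow> 'a"
    and T :: "real \<Rightarrow> 'a \<Rightarrow>\<^sub>L 'a"
    and n :: nat
    and a :: "nat \<Rightarrow> real"
  assumes "complete_orthonormal_system e"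
    and "C0_semigroup T"
    and "infinitesimal_generator D A T"
    and "exponentially_stable T"
    and "n \<ge> 1"
    and "\<And>i. a i \<ge> 0"
    and "summable a"
    and "feasible T e n a \<noteq> {}"
  shows "(\<exists>p. optimal_solution (f_obj T e n) (feasible T e n a) p) \<and>
         (\<exists>p. optimal_solution (g_obj T e n) (feasible T e n a) p)"
proof -
  obtain M \<omega> where M: "M > 0" "\<omega> > 0" "\<And>t. t \<ge> 0 \<Longrightarrow> norm (T t) \<le> M * exp (- \<omega> * t)"
    using assms(4) unfolding exponentially_stable_def by blast
  interpret stable_system e T M \<omega>
    by (rule stable_system.intro) (use assms(1,2) M in auto)
  show ?thesis
    using f_obj_has_minimizer[OF assms(7,5,8)] g_obj_has_minimizer[OF assms(7,5,8)] by blast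
qed

end
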